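(* Let $\mathscr{T}=(V,E)$ be a countably infinite rooted and leafless directed tree, and $\boldsymbol\lambda=\{\lambda_v\}_{v\in V^\circ}\subseteq(0,\infty)$. Assume that $S_{\boldsymbol\lambda}\in\mathbf{B}(\ell^2(V))$ is balanced and left-invertible. Assume also that $\dim\ker S_{\boldsymbol\lambda}^*<\infty$ and $\{e'_j\}_{j\in J}$ is a separated basis of $\ker S_{\boldsymbol\lambda}^*$. Then $$\mathcal{GM}(S_{\boldsymbol\lambda})=\Big\{\hat\varphi\colon\mathbb{N}_0\to\mathbf{B}(\ker S_{\boldsymbol\lambda}^* )\ \Big|\ \big\{\langle\hat\varphi(n)e'_j,e'_i\rangle\big\}_{n=0}^\infty\in H^\infty\big(\{\|S_{\boldsymbol\lambda}^ne_{\mathsf{root}}\|^2\}_{n=0}^\infty\big)\text{ for all } i,j\in J\Big\}.$$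
   Context: $\mathbb{N}_0=\{0,1,2,\dots\}$. A rooted directed tree $\mathscr{T}=(V,E)$ has a unique vertex $\mathsf{root}$ without parent; every other vertex $v$ has a unique parent $\mathsf{par}(v)$; $V^\circ=V\setminus\{\mathsf{root}\}$; $|v|$ is the unique $k\in\mathbb{N}_0$ with $\mathsf{par}^k(v)=\mathsf{root}$; $V_k=\{v\in V:|v|=k\}$. The tree is leafless if every vertex has at least one child. $\ell^2(V)$ is the space of square-summable functions $V\to\mathbb{C}$, $e_u$ is the characteristic function of $\{u\}$, and $\ell^2(V_k)$ is the subspace of functions vanishing off $V_k$. The weighted shift $S_{\boldsymbol\lambda}$ with weights $\boldsymbol\lambda$ is the operator in $\ell^2(V)$ given by $(S_{\boldsymbol\lambda}f)(v)=\lambda_vf(\mathsf{par}(v))$ for $v\in V^\circ$ and $(S_{\boldsymbol\lambda}f)(\mathsf{root})=0$, on its maximal domain; $\mathbf{B}(\cdot)$ denotes bounded everywhere defined operators. Bounded weighted shifts on rooted directed trees are analytic ($\bigcap_n S_{\boldsymbol\lambda}^n(\ell^2(V))=\{0\}$). Left-invertible means having a bounded left inverse. $S_{\boldsymbol\lambda}$ is balanced if $\|S_{\boldsymbol\lambda}e_u\|=\|S_{\boldsymbol\lambda}e_v\|$ whenever $u,v\in V$ and $|u|=|v|$. A separated basis of $\ker S_{\boldsymbol\lambda}^*$ is an orthonormal basis $\{e'_j\}_{j\in J}$ such that for every $j\in J$ there is $k_j\in\mathbb{N}_0$ with $e'_j\in\ell^2(V_{k_j})$. Generalized multipliers: put $T=S_{\boldsymbol\lambda}$,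 $H=\ell^2(V)$, $\mathcal{E}=\ker T^*$, $P_{\mathcal{E}}$ the orthogonal projection onto $\mathcal{E}$, $L=(T^*T)^{-1}T^*$, $r=1/r(L)$ ($r(L)$ the spectral radius), $\mathbb{D}_r=\{|z|<r\}$. For $f\in H$ let $(Uf)(z)=\sum_{n=0}^\infty(P_{\mathcal{E}}L^nf)z^n$, $z\in\mathbb{D}_r$; $U$ is injective, and $\mathcal{H}:=U(H)$ is a space of $\mathcal{E}$-valued analytic functions on $\mathbb{D}_r$ with the inner product making $U\colon H\to\mathcal{H}$ unitary. For $\boldsymbol f\in\mathcal{H}$, $\hat{\boldsymbol f}(n)=P_{\mathcal{E}}L^nU^*\boldsymbol f$ are its Taylor coefficients. For $\hat\varphi\colon\mathbb{N}_0\to\mathbf{B}(\mathcal{E})$, $M_{\hat\varphi}$ has domain consisting of $\boldsymbol f\in\mathcal{H}$ for which there is $\boldsymbol g\in\mathcal{H}$ with $\hat{\boldsymbol g}(n)=\sum_{k=0}^n\hat\varphi(k)\hat{\boldsymbol f}(n-k)$ for all $n\in\mathbb{N}_0$, and $M_{\hat\varphi}\boldsymbol f=\boldsymbol g$. $\mathcal{GM}(S_{\boldsymbol\lambda})$ is the set of all $\hat\varphi\colon\mathbb{N}_0\to\mathbf{B}(\mathcal{E})$ for which the domain of $M_{\hat\varphi}$ is all of $\mathcal{H}$. For complex sequences $a,b$, $(a*b)(n)=\sum_{k=0}^na_kb_{n-k}$. For $\beta=\{\beta_n\}_{n=0}^\infty\subset(0,\infty)$, $\ell^2(\beta)=\{a\in\mathbb{C}^{\mathbb{N}_0}:\sum_{n=0}^\infty|a_n|^2\beta_n<\infty\}$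 and $H^\infty(\beta)=\{a\in\mathbb{C}^{\mathbb{N}_0}: a*b\in\ell^2(\beta)\text{ for every }b\in\ell^2(\beta)\}$. *)

theory Defs
  imports "HOL-Analysis.Analysis" "HOL-Library.Function_Algebras"
begin

(* Addition, subtraction and finite sums of functions are pointwise (Function_Algebras). *)

definition cscale :: "complex \<Rightarrow> ('v \<Rightarrow> complex) \<Rightarrow> 'v \<Rightarrow> complex" (infixr "*\<^sub>C" 75)
  where "c *\<^sub>C f = (\<lambda>v. c * f v)"

interpretation cfun: vector_space "cscale :: complex \<Rightarrow> ('v \<Rightarrow> complex) \<Rightarrow> 'v \<Rightarrow> complex"
  by standard (simp_all add: cscale_def fun_eq_iff algebra_simps)

(* Functions on V are represented by functions on the whole type that vanish off V;
   hence ell2 W, for W a subset of V, is the subspace of functions in ell2 V vanishing off W. *)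
definition ell2 :: "'v set \<Rightarrow> ('v \<Rightarrow> complex) set"
  where "ell2 V = {f. (\<forall>v. v \<notin> V \<longrightarrow> f v = 0) \<and> (\<lambda>v. (cmod (f v))\<^sup>2) summable_on V}"

definition ell2_inner :: "'v set \<Rightarrow> ('v \<Rightarrow> complex) \<Rightarrow> ('v \<Rightarrow> complex) \<Rightarrow> complex"
  where "ell2_inner V f g = (\<Sum>\<^sub>\<infinity>v\<in>V. f v * cnj (g v))"

definition ell2_norm :: "'v set \<Rightarrow> ('v \<Rightarrow> complex) \<Rightarrow> real"
  where "ell2_norm V f = sqrt (\<Sum>\<^sub>\<infinity>v\<in>V. (cmod (f v))\<^sup>2)"

definition unit_vec :: "'v \<Rightarrow> 'v \<Rightarrow> complex"
  where "unit_vec u = (\<lambda>v. if v = u then 1 else 0)"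

(* Sum of a norm-convergent series in ell2 V. *)
definition ell2_suminf :: "'v set \<Rightarrow> (nat \<Rightarrow> 'v \<Rightarrow> complex) \<Rightarrow> 'v \<Rightarrow> complex"
  where "ell2_suminf V a =
    (THE s. s \<in> ell2 V \<and> (\<lambda>N. ell2_norm V ((\<Sum>n<N. a n) - s)) \<longlonglongrightarrow> 0)"

definition ell2_proj :: "'v set \<Rightarrow> ('v \<Rightarrow> complex) set \<Rightarrow> ('v \<Rightarrow> complex) \<Rightarrow> 'v \<Rightarrow> complex"
  where "ell2_proj V M f = (THE g. g \<in> M \<and> (\<forall>h\<in>M. ell2_inner V (f - g) h = 0))"

definition finite_dimensional :: "('v \<Rightarrow> complex) set \<Rightarrow> bool"
  where "finite_dimensional M \<longleftrightarrow> (\<exists>B. finite B \<and> B \<subseteq> M \<and> M \<subseteq> cfun.span B)"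

definition orthonormal_basis ::
    "'v set \<Rightarrow> ('v \<Rightarrow> complex) set \<Rightarrow> 'j set \<Rightarrow> ('j \<Rightarrow> 'v \<Rightarrow> complex) \<Rightarrow> bool"
  where "orthonormal_basis V M J b \<longleftrightarrow>
    (\<forall>j\<in>J. b j \<in> M) \<and>
    (\<forall>i\<in>J. \<forall>j\<in>J. ell2_inner V (b i) (b j) = (if i = j then 1 else 0)) \<and>
    (\<forall>f\<in>M. \<forall>\<epsilon>>0. \<exists>g\<in>cfun.span (b ` J). ell2_norm V (f - g) < \<epsilon>)"

(* A is an everywhere defined bounded operator on the subspace M of ell2 V;
   nothing is said about the values of A off M. *)
definition bounded_operator ::
    "'v set \<Rightarrow> ('v \<Rightarrow> complex) set \<Rightarrow> (('v \<Rightarrow> complex) \<Rightarrow> 'v \<Rightarrow> complex) \<Rightarrow> bool"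
  where "bounded_operator V M A \<longleftrightarrow>
    (\<forall>f\<in>M. A f \<in> M) \<and>
    (\<forall>f\<in>M. \<forall>g\<in>M. A (f + g) = A f + A g) \<and>
    (\<forall>c. \<forall>f\<in>M. A (c *\<^sub>C f) = c *\<^sub>C A f) \<and>
    (\<exists>C. \<forall>f\<in>M. ell2_norm V (A f) \<le> C * ell2_norm V f)"

(* The set B(M). Extensionality makes its members correspond one-to-one to operators on M. *)
definition bounded_operators ::
    "'v set \<Rightarrow> ('v \<Rightarrow> complex) set \<Rightarrow> (('v \<Rightarrow> complex) \<Rightarrow> 'v \<Rightarrow> complex) set"
  where "bounded_operators V M = {A \<in> extensional M. bounded_operator V M A}"

definition adj ::
    "'v set \<Rightarrow> (('v \<Rightarrow> complex) \<Rightarrow> 'v \<Rightarrow> complex) \<Rightarrow> ('v \<Rightarrow> complex) \<Rightarrow> 'v \<Rightarrow> complex"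
  where "adj V T g =
    (THE h. h \<in> ell2 V \<and> (\<forall>f\<in>ell2 V. ell2_inner V (T f) g = ell2_inner V f h))"

definition ker_adj :: "'v set \<Rightarrow> (('v \<Rightarrow> complex) \<Rightarrow> 'v \<Rightarrow> complex) \<Rightarrow> ('v \<Rightarrow> complex) set"
  where "ker_adj V T = {f \<in> ell2 V. adj V T f = 0}"

definition left_invertible :: "'v set \<Rightarrow> (('v \<Rightarrow> complex) \<Rightarrow> 'v \<Rightarrow> complex) \<Rightarrow> bool"
  where "left_invertible V T \<longleftrightarrow>
    (\<exists>B. bounded_operator V (ell2 V) B \<and> (\<forall>f\<in>ell2 V. B (T f) = f))"

definition spectrum :: "'v set \<Rightarrow> (('v \<Rightarrow> complex) \<Rightarrow> 'v \<Rightarrow> complex) \<Rightarrow> complex set"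
  where "spectrum V A = {z. \<not> (\<exists>B. bounded_operator V (ell2 V) B \<and>
    (\<forall>f\<in>ell2 V. B (A f - z *\<^sub>C f) = f \<and> A (B f) - z *\<^sub>C B f = f))}"

definition spectral_radius :: "'v set \<Rightarrow> (('v \<Rightarrow> complex) \<Rightarrow> 'v \<Rightarrow> complex) \<Rightarrow> real"
  where "spectral_radius V A = (SUP z\<in>spectrum V A. cmod z)"

(* Reachability from the root along directed edges is the condition that every vertex v
   has a depth, i.e. that an iterate of par maps v to the root. *)
definition rooted_directed_tree :: "'v set \<Rightarrow> ('v \<times> 'v) set \<Rightarrow> bool"
  where "rooted_directed_tree V E \<longleftrightarrow>
    E \<subseteq> V \<times> V \<and>
    (\<exists>!r. r \<in> V \<and> (\<forall>u. (u, r) \<notin> E)) \<and>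
    (\<forall>v\<in>V. (\<exists>u. (u, v) \<in> E) \<longrightarrow> (\<exists>!u. (u, v) \<in> E)) \<and>
    (\<forall>r\<in>V. (\<forall>u. (u, r) \<notin> E) \<longrightarrow> (\<forall>v\<in>V. (r, v) \<in> E\<^sup>*))"

definition leafless :: "'v set \<Rightarrow> ('v \<times> 'v) set \<Rightarrow> bool"
  where "leafless V E \<longleftrightarrow> (\<forall>v\<in>V. \<exists>w. (v, w) \<in> E)"

definition tree_root :: "'v set \<Rightarrow> ('v \<times> 'v) set \<Rightarrow> 'v"
  where "tree_root V E = (THE r. r \<in> V \<and> (\<forall>u. (u, r) \<notin> E))"

definition par :: "('v \<times> 'v) set \<Rightarrow> 'v \<Rightarrow> 'v"
  where "par E v = (THE u. (u, v) \<in> E)"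

(* Stated with edge paths rather than iterates of par, since par is unspecified at the root. *)
definition depth :: "'v set \<Rightarrow> ('v \<times> 'v) set \<Rightarrow> 'v \<Rightarrow> nat"
  where "depth V E v = (THE k. (tree_root V E, v) \<in> E ^^ k)"

definition level :: "'v set \<Rightarrow> ('v \<times> 'v) set \<Rightarrow> nat \<Rightarrow> 'v set"
  where "level V E k = {v \<in> V. depth V E v = k}"

(* Total formula for the weighted shift. Its maximal domain consists of those f in ell2 V
   whose image lies in ell2 V, so bounded_operator V (ell2 V) (weighted_shift V E lam)
   includes the claim that this domain is all of ell2 V. *)
definition weighted_shift ::
    "'v set \<Rightarrow> ('v \<times> 'v) set \<Rightarrow> ('v \<Rightarrow> real) \<Rightarrow> ('v \<Rightarrow> complex) \<Rightarrow> 'v \<Rightarrow> complex"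
  where "weighted_shift V E lam f =
    (\<lambda>v. if v \<in> V - {tree_root V E} then complex_of_real (lam v) * f (par E v) else 0)"

definition balanced :: "'v set \<Rightarrow> ('v \<times> 'v) set \<Rightarrow> ('v \<Rightarrow> real) \<Rightarrow> bool"
  where "balanced V E lam \<longleftrightarrow>
    (\<forall>u\<in>V. \<forall>v\<in>V. depth V E u = depth V E v \<longrightarrow>
      ell2_norm V (weighted_shift V E lam (unit_vec u)) = ell2_norm V (weighted_shift V E lam (unit_vec v)))"

definition separated_basis ::
    "'v set \<Rightarrow> ('v \<times> 'v) set \<Rightarrow> ('v \<Rightarrow> real) \<Rightarrow> 'j set \<Rightarrow> ('j \<Rightarrow> 'v \<Rightarrow> complex) \<Rightarrow> bool"
  where "separated_basis V E lam J b \<longleftrightarrow>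
    orthonormal_basis V (ker_adj V (weighted_shift V E lam)) J b \<and>
    (\<forall>j\<in>J. \<exists>k. b j \<in> ell2 (level V E k))"

definition left_inv :: "'v set \<Rightarrow> (('v \<Rightarrow> complex) \<Rightarrow> 'v \<Rightarrow> complex) \<Rightarrow> ('v \<Rightarrow> complex) \<Rightarrow> 'v \<Rightarrow> complex"
  where "left_inv V T f = inv_into (ell2 V) (\<lambda>g. adj V T (T g)) (adj V T f)"

definition model_coeff ::
    "'v set \<Rightarrow> (('v \<Rightarrow> complex) \<Rightarrow> 'v \<Rightarrow> complex) \<Rightarrow> ('v \<Rightarrow> complex) \<Rightarrow> nat \<Rightarrow> 'v \<Rightarrow> complex"
  where "model_coeff V T f n = ell2_proj V (ker_adj V T) ((left_inv V T ^^ n) f)"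

(* A function on the disc of radius r is represented by its extension by 0. *)
definition model_map ::
    "'v set \<Rightarrow> (('v \<Rightarrow> complex) \<Rightarrow> 'v \<Rightarrow> complex) \<Rightarrow> ('v \<Rightarrow> complex) \<Rightarrow> complex \<Rightarrow> 'v \<Rightarrow> complex"
  where "model_map V T f =
    (\<lambda>z. if cmod z < 1 / spectral_radius V (left_inv V T)
         then ell2_suminf V (\<lambda>n. z ^ n *\<^sub>C model_coeff V T f n) else 0)"

definition model_space ::
    "'v set \<Rightarrow> (('v \<Rightarrow> complex) \<Rightarrow> 'v \<Rightarrow> complex) \<Rightarrow> (complex \<Rightarrow> 'v \<Rightarrow> complex) set"
  where "model_space V T = model_map V T ` ell2 V"

(* The adjoint of the unitary map model_map is its inverse. *)
definition taylor_coeff ::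
    "'v set \<Rightarrow> (('v \<Rightarrow> complex) \<Rightarrow> 'v \<Rightarrow> complex) \<Rightarrow> (complex \<Rightarrow> 'v \<Rightarrow> complex) \<Rightarrow> nat \<Rightarrow> 'v \<Rightarrow> complex"
  where "taylor_coeff V T F n = model_coeff V T (inv_into (ell2 V) (model_map V T) F) n"

definition multiplier_domain ::
    "'v set \<Rightarrow> (('v \<Rightarrow> complex) \<Rightarrow> 'v \<Rightarrow> complex) \<Rightarrow> (nat \<Rightarrow> ('v \<Rightarrow> complex) \<Rightarrow> 'v \<Rightarrow> complex)
      \<Rightarrow> (complex \<Rightarrow> 'v \<Rightarrow> complex) set"
  where "multiplier_domain V T \<phi> = {F \<in> model_space V T. \<exists>G\<in>model_space V T.
    \<forall>n. taylor_coeff V T G n = (\<Sum>k\<le>n. \<phi> k (taylor_coeff V T F (n - k)))}"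

definition generalized_multipliers ::
    "'v set \<Rightarrow> (('v \<Rightarrow> complex) \<Rightarrow> 'v \<Rightarrow> complex) \<Rightarrow> (nat \<Rightarrow> ('v \<Rightarrow> complex) \<Rightarrow> 'v \<Rightarrow> complex) set"
  where "generalized_multipliers V T =
    {\<phi>. (\<forall>n. \<phi> n \<in> bounded_operators V (ker_adj V T)) \<and> multiplier_domain V T \<phi> = model_space V T}"

definition conv :: "(nat \<Rightarrow> complex) \<Rightarrow> (nat \<Rightarrow> complex) \<Rightarrow> nat \<Rightarrow> complex"
  where "conv a b n = (\<Sum>k\<le>n. a k * b (n - k))"

definition weighted_ell2 :: "(nat \<Rightarrow> real) \<Rightarrow> (nat \<Rightarrow> complex) set"
  where "weighted_ell2 \<beta> = {a. summable (\<lambda>n. (cmod (a n))\<^sup>2 * \<beta> n)}"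

definition H_inf :: "(nat \<Rightarrow> real) \<Rightarrow> (nat \<Rightarrow> complex) set"
  where "H_inf \<beta> = {a. \<forall>b\<in>weighted_ell2 \<beta>. conv a b \<in> weighted_ell2 \<beta>}"

end

theory Submission
  imports Defs
begin

text \<open>Balancedness makes \<open>S\<^sup>* S\<close> act on level \<open>k\<close> as a scalar \<open>q k\<close>, so the vectors \<open>S\<^sup>n e'\<^sub>j\<close> of a separated
  basis are mutually orthogonal, with
  \<open>\<parallel>S\<^sup>n e'\<^sub>j\<parallel>\<^sup>2 = q k\<^sub>j \<cdots> q (k\<^sub>j + n - 1)\<close>. Left-invertibility and boundedness keep \<open>q\<close> between two positive constants, so for fixed
  \<open>j\<close> this is comparable to \<open>\<beta> n = \<parallel>S\<^sup>n e\<parallel>\<^sup>2\<close> with \<open>e\<close> the root vector. Moreover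
  \<open>P L\<^sup>m S\<^sup>n e'\<^sub>j\<close> is \<open>e'\<^sub>j\<close> for \<open>m = n\<close> and zero otherwise. Hence the Taylor coefficient sequences of the
  model space are exactly the sequences in \<open>ker S\<^sup>*\<close> all of whose coordinates lie in \<open>\<ell>\<^sup>2(\<beta>)\<close>; in
  coordinates a multiplier is a finite matrix of convolutions, and testing it on one coordinate at
  a time gives the claim.\<close>

section \<open>Square-summable functions\<close>

text \<open>The two halves of the description of Taylor sequences have different sources. That
  coordinates lie in \<open>weighted_ell2 \<beta>\<close> follows from a levelwise estimate for the
  powers of \<open>L\<close>; that every such sequence occurs follows from an explicit preimage,
  \<open>lift\<close>. Both exploit that a basis vector lives on one level k: coefficient n is
  controlled by level n + k of f, and the series defining the preimage has at most one nonzero term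
  at each vertex. The price is the passage from \<beta> (n + k) to \<beta> n, which is where the
  bounds on \<open>q\<close> enter. \<open>H_inf\<close> and \<open>multiplier_domain\<close> are
  both conditions on where images lie, so they can be matched coordinate by coordinate. A separate
  obstacle is that the model consists of functions on a disc whose radius is the reciprocal of a
  spectral radius. Reading coefficients off a function requires a neighbourhood of 0 inside that
  disc on which the series converges. Hence the Neumann series, which bounds the spectrum, and the
  explicit eigenvector, which shows that the spectral radius is positive.\<close>

lemma ell2_vanishes: "f \<in> ell2 V \<Longrightarrow> v \<notin> V \<Longrightarrow> f v = 0"
  by (simp add: ell2_def)

lemma ell2_norm_nonneg [simp]: "0 \<le> ell2_norm W f"
  by (simp add: ell2_norm_def infsum_nonneg)

lemma ell2_norm_power2: "(ell2_norm W f)\<^sup>2 = (\<Sum>\<^sub>\<infinity>v\<in>W. (cmod (f v))\<^sup>2)"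
  by (simp add: ell2_norm_def infsum_nonneg)

lemma ell2_summable: "f \<in> ell2 V \<Longrightarrow> W \<subseteq> V \<Longrightarrow> (\<lambda>v. (cmod (f v))\<^sup>2) summable_on W"
  unfolding ell2_def by (auto intro: summable_on_subset_banach)

lemma L2_set_le_ell2_norm:
  assumes "(\<lambda>v. (cmod (f v))\<^sup>2) summable_on W" "finite F" "F \<subseteq> W"
  shows "L2_set (\<lambda>v. cmod (f v)) F \<le> ell2_norm W f"
  unfolding L2_set_def ell2_norm_def
  by (intro real_sqrt_le_mono finite_sum_le_infsum) (use assms in auto)

text \<open>Membership and norm bounds are reduced to finite sets, where the triangle and
  Cauchy-Schwarz inequalities are available for \<open>L2_set\<close>.\<close>

lemma summable_ell2_norm_boundI:
  assumes "\<And>F. finite F \<Longrightarrow> F \<subseteq> W \<Longrightarrow> L2_set (\<lambda>v. cmod (f v)) F \<le> B"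
  shows "(\<lambda>v. (cmod (f v))\<^sup>2) summable_on W" and "ell2_norm W f \<le> B"
proof -
  have B: "0 \<le> B"
    using assms[of "{}"] by simp
  have *: "(\<Sum>v\<in>F. (cmod (f v))\<^sup>2) \<le> B\<^sup>2" if "finite F" "F \<subseteq> W" for F
    using power_mono[OF assms[OF that], of 2] by (simp add: L2_set_def sum_nonneg)
  show s: "(\<lambda>v. (cmod (f v))\<^sup>2) summable_on W"
    by (intro nonneg_bdd_above_summable_on bdd_aboveI2[of _ _ "B\<^sup>2"]) (use * in auto)
  have "(\<Sum>\<^sub>\<infinity>v\<in>W. (cmod (f v))\<^sup>2) \<le> B\<^sup>2"
    using infsum_le_finite_sums[OF s] * by blast
  then show "ell2_norm W f \<le> B"
    unfolding ell2_norm_def by (rule real_le_lsqrt[OF B])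
qed

lemma ell2_boundI:
  assumes "\<And>v. v \<notin> V \<Longrightarrow> f v = 0"
    and "\<And>F. finite F \<Longrightarrow> F \<subseteq> V \<Longrightarrow> L2_set (\<lambda>v. cmod (f v)) F \<le> B"
  shows "f \<in> ell2 V" and "ell2_norm V f \<le> B"
  using summable_ell2_norm_boundI[where W = V and f = f and B = B] assms
  unfolding ell2_def by auto

lemma ell2_add_norm:
  assumes "f \<in> ell2 V" "g \<in> ell2 V"
  shows "f + g \<in> ell2 V" and "ell2_norm V (f + g) \<le> ell2_norm V f + ell2_norm V g"
proof -
  have *: "L2_set (\<lambda>v. cmod ((f + g) v)) F \<le> ell2_norm V f + ell2_norm V g"
    if F: "finite F" "F \<subseteq> V" for F
  proof -
    have "L2_set (\<lambda>v. cmod ((f + g) v)) F \<le> L2_set (\<lambda>v. cmod (f v) + cmod (g v)) F"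
      by (rule L2_set_mono) (auto simp: norm_triangle_ineq)
    also have "\<dots> \<le> L2_set (\<lambda>v. cmod (f v)) F + L2_set (\<lambda>v. cmod (g v)) F"
      by (rule L2_set_triangle_ineq)
    also have "\<dots> \<le> ell2_norm V f + ell2_norm V g"
      by (intro add_mono L2_set_le_ell2_norm ell2_summable[of _ V]) (use assms F in auto)
    finally show ?thesis .
  qed
  show "f + g \<in> ell2 V" "ell2_norm V (f + g) \<le> ell2_norm V f + ell2_norm V g"
    by (rule ell2_boundI[OF _ *]; use assms in \<open>simp add: ell2_vanishes\<close>)+
qed

lemma ell2_norm_cscale: "ell2_norm W (c *\<^sub>C f) = cmod c * ell2_norm W f"
  by (simp add: ell2_norm_def cscale_def norm_mult power_mult_distrib infsum_cmult_right'
      real_sqrt_mult)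

lemma ell2_cscale: "f \<in> ell2 V \<Longrightarrow> c *\<^sub>C f \<in> ell2 V"
  by (simp add: ell2_def cscale_def norm_mult power_mult_distrib summable_on_cmult_right)

lemma ell2_zero [simp]: "0 \<in> ell2 V"
  by (simp add: ell2_def)

lemma ell2_norm_zero [simp]: "ell2_norm V 0 = 0"
  by (simp add: ell2_norm_def)

lemma cscale_minus1: "(-1) *\<^sub>C f = - f"
  by (simp add: cscale_def fun_eq_iff)

lemma ell2_uminus: "f \<in> ell2 V \<Longrightarrow> - f \<in> ell2 V"
  using ell2_cscale[of f V "-1"] by (simp add: cscale_minus1)

lemma ell2_norm_uminus: "ell2_norm V (- f) = ell2_norm V f"
  using ell2_norm_cscale[of V "-1" f] by (simp add: cscale_minus1)

lemma ell2_diff_norm: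
  assumes "f \<in> ell2 V" "g \<in> ell2 V"
  shows "f - g \<in> ell2 V" and "ell2_norm V (f - g) \<le> ell2_norm V f + ell2_norm V g"
  using ell2_add_norm[of f V "- g"] assms by (auto simp: ell2_uminus ell2_norm_uminus)

lemma sum_fun_apply: "(\<Sum>i\<in>I. f i) x = (\<Sum>i\<in>I. f i x)"
  by (induction I rule: infinite_finite_induct) auto

lemma ell2_sum_norm:
  assumes "\<And>i. i \<in> I \<Longrightarrow> f i \<in> ell2 V"
  shows "(\<Sum>i\<in>I. f i) \<in> ell2 V \<and> ell2_norm V (\<Sum>i\<in>I. f i) \<le> (\<Sum>i\<in>I. ell2_norm V (f i))"
  using assms
proof (induction I rule: infinite_finite_induct)
  case (insert i I)
  then have "f i \<in> ell2 V" "sum f I \<in> ell2 V" "ell2_norm V (sum f I) \<le> (\<Sum>i\<in>I. ell2_norm V (f i))"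
    by blast+
  then have "f i + sum f I \<in> ell2 V \<and>
      ell2_norm V (f i + sum f I) \<le> ell2_norm V (f i) + (\<Sum>i\<in>I. ell2_norm V (f i))"
    using ell2_add_norm[of "f i" V "sum f I"] by linarith
  then show ?case
    unfolding sum.insert[OF insert.hyps] .
qed auto

lemma cmod_le_ell2_norm:
  assumes "f \<in> ell2 V"
  shows "cmod (f v) \<le> ell2_norm V f"
proof (cases "v \<in> V")
  case True
  then show ?thesis
    using L2_set_le_ell2_norm[OF ell2_summable[OF assms subset_refl], of "{v}"]
    by (simp add: L2_set_def)
qed (use assms in \<open>simp add: ell2_vanishes\<close>)

lemma ell2_norm_eq_0: "f \<in> ell2 V \<Longrightarrow> ell2_norm V f = 0 \<longleftrightarrow> f = 0"
  using cmod_le_ell2_norm[of f V] by (metis ell2_norm_zero ext norm_le_zero_iff zero_fun_apply)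

text \<open>The index set is arbitrary because the inequality is also applied on the children of a
  vertex and on a single level.\<close>

lemma cauchy_schwarz_summable:
  fixes f g :: "'a \<Rightarrow> complex"
  assumes "(\<lambda>v. (cmod (f v))\<^sup>2) summable_on W" "(\<lambda>v. (cmod (g v))\<^sup>2) summable_on W"
  shows "(\<lambda>v. norm (f v * g v)) summable_on W"
    and "cmod (\<Sum>\<^sub>\<infinity>v\<in>W. f v * g v) \<le> ell2_norm W f * ell2_norm W g"
proof -
  have *: "(\<Sum>v\<in>F. cmod (f v * g v)) \<le> ell2_norm W f * ell2_norm W g"
    if F: "finite F" "F \<subseteq> W" for F
  proof -
    have "(\<Sum>v\<in>F. cmod (f v * g v)) = (\<Sum>v\<in>F. \<bar>cmod (f v)\<bar> * \<bar>cmod (g v)\<bar>)"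
      by (simp add: norm_mult)
    also have "\<dots> \<le> L2_set (\<lambda>v. cmod (f v)) F * L2_set (\<lambda>v. cmod (g v)) F"
      by (rule L2_set_mult_ineq)
    also have "\<dots> \<le> ell2_norm W f * ell2_norm W g"
      by (intro mult_mono L2_set_le_ell2_norm) (use assms F in auto)
    finally show ?thesis .
  qed
  show s: "(\<lambda>v. norm (f v * g v)) summable_on W"
    by (intro nonneg_bdd_above_summable_on bdd_aboveI2[of _ _ "ell2_norm W f * ell2_norm W g"])
      (use * in auto)
  show "cmod (\<Sum>\<^sub>\<infinity>v\<in>W. f v * g v) \<le> ell2_norm W f * ell2_norm W g"
    using norm_infsum_bound[OF s] infsum_le_finite_sums[OF s] * by (meson order_trans)
qed

section \<open>The inner product\<close>

lemma ell2_inner_abs_summable: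
  "f \<in> ell2 V \<Longrightarrow> g \<in> ell2 V \<Longrightarrow> (\<lambda>v. norm (f v * cnj (g v))) summable_on V"
  using cauchy_schwarz_summable(1)[of f V "\<lambda>v. cnj (g v)"] by (simp add: ell2_def)

lemma ell2_inner_summable:
  "f \<in> ell2 V \<Longrightarrow> g \<in> ell2 V \<Longrightarrow> (\<lambda>v. f v * cnj (g v)) summable_on V"
  by (rule abs_summable_summable[OF ell2_inner_abs_summable])

lemma ell2_cauchy_schwarz:
  assumes "f \<in> ell2 V" "g \<in> ell2 V"
  shows "cmod (ell2_inner V f g) \<le> ell2_norm V f * ell2_norm V g"
proof -
  have "ell2_norm V (\<lambda>v. cnj (g v)) = ell2_norm V g"
    by (simp add: ell2_norm_def)
  then show ?thesis
    using cauchy_schwarz_summable(2)[of f V "\<lambda>v. cnj (g v)"] assms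
    by (simp add: ell2_inner_def ell2_def)
qed

lemma ell2_inner_commute: "ell2_inner V g f = cnj (ell2_inner V f g)"
  unfolding ell2_inner_def infsum_cnj[symmetric] by (simp add: mult.commute)

lemma ell2_inner_cscale_left: "ell2_inner V (c *\<^sub>C f) g = c * ell2_inner V f g"
  unfolding ell2_inner_def cscale_def by (simp add: mult.assoc infsum_cmult_right')

lemma ell2_inner_cscale_right: "ell2_inner V f (c *\<^sub>C g) = cnj c * ell2_inner V f g"
  by (metis ell2_inner_commute ell2_inner_cscale_left complex_cnj_mult)

lemma ell2_inner_add_left:
  assumes "f \<in> ell2 V" "g \<in> ell2 V" "h \<in> ell2 V"
  shows "ell2_inner V (f + g) h = ell2_inner V f h + ell2_inner V g h"
  unfolding ell2_inner_def
  using infsum_add[OF ell2_inner_summable[of f V h] ell2_inner_summable[of g V h]] assms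
  by (simp add: algebra_simps)

lemma ell2_inner_uminus_left: "ell2_inner V (- f) h = - ell2_inner V f h"
  using ell2_inner_cscale_left[of V "-1" f h] by (simp add: cscale_minus1)

lemma ell2_inner_diff_left:
  assumes "f \<in> ell2 V" "g \<in> ell2 V" "h \<in> ell2 V"
  shows "ell2_inner V (f - g) h = ell2_inner V f h - ell2_inner V g h"
  using ell2_inner_add_left[of f V "- g" h] assms
  by (simp add: ell2_uminus ell2_inner_uminus_left)

lemma ell2_inner_diff_right:
  assumes "f \<in> ell2 V" "g \<in> ell2 V" "h \<in> ell2 V"
  shows "ell2_inner V h (f - g) = ell2_inner V h f - ell2_inner V h g"
  by (metis assms complex_cnj_diff ell2_inner_commute ell2_inner_diff_left)

lemma ell2_inner_zero_left [simp]: "ell2_inner V 0 h = 0"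
  by (simp add: ell2_inner_def)

lemma ell2_inner_sum_left:
  assumes "\<And>i. i \<in> I \<Longrightarrow> f i \<in> ell2 V" "h \<in> ell2 V"
  shows "ell2_inner V (\<Sum>i\<in>I. f i) h = (\<Sum>i\<in>I. ell2_inner V (f i) h)"
  using assms
proof (induction I rule: infinite_finite_induct)
  case (insert i I)
  have "ell2_inner V (f i + sum f I) h = ell2_inner V (f i) h + ell2_inner V (sum f I) h"
    using ell2_inner_add_left[of "f i" V "sum f I" h] ell2_sum_norm[of I f V] insert.prems by blast
  also have "ell2_inner V (sum f I) h = (\<Sum>i\<in>I. ell2_inner V (f i) h)"
    using insert by blast
  also have "ell2_inner V (f i) h + \<dots> = (\<Sum>i\<in>insert i I. ell2_inner V (f i) h)"
    by (rule sum.insert[OF insert.hyps, symmetric])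
  also have "f i + sum f I = sum f (insert i I)"
    by (rule sum.insert[OF insert.hyps, symmetric])
  finally show ?case .
qed auto

lemma ell2_inner_self:
  assumes "f \<in> ell2 V"
  shows "ell2_inner V f f = complex_of_real ((ell2_norm V f)\<^sup>2)"
proof -
  have "((\<lambda>v. complex_of_real ((cmod (f v))\<^sup>2)) has_sum complex_of_real ((ell2_norm V f)\<^sup>2)) V"
    unfolding ell2_norm_power2
    by (intro has_sum_of_real has_sum_infsum ell2_summable[of f V]) (use assms in auto)
  from infsumI[OF this] show ?thesis
    unfolding complex_norm_square ell2_inner_def .
qed

lemma ell2_inner_self_eq_0: "f \<in> ell2 V \<Longrightarrow> ell2_inner V f f = 0 \<longleftrightarrow> f = 0"
  by (simp add: ell2_inner_self ell2_norm_eq_0)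

lemma unit_vec_ell2: "u \<in> V \<Longrightarrow> unit_vec u \<in> ell2 V"
  and ell2_norm_unit_vec: "u \<in> V \<Longrightarrow> ell2_norm V (unit_vec u) = 1"
proof -
  assume u: "u \<in> V"
  have 1: "(\<lambda>v. (cmod (unit_vec u v))\<^sup>2) summable_on V \<longleftrightarrow>
      (\<lambda>v. (cmod (unit_vec u v))\<^sup>2) summable_on {u}"
    by (rule summable_on_cong_neutral) (use u in \<open>auto simp: unit_vec_def\<close>)
  have 2: "(\<Sum>\<^sub>\<infinity>v\<in>V. (cmod (unit_vec u v))\<^sup>2) = (\<Sum>\<^sub>\<infinity>v\<in>{u}. (cmod (unit_vec u v))\<^sup>2)"
    by (rule infsum_cong_neutral) (use u in \<open>auto simp: unit_vec_def\<close>)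
  show "unit_vec u \<in> ell2 V"
    using 1 u by (auto simp: ell2_def unit_vec_def)
  show "ell2_norm V (unit_vec u) = 1"
    using 2 by (simp add: ell2_norm_def unit_vec_def)
qed

text \<open>This replaces completeness. Point evaluations are contractive, so the series converges
  pointwise; norm bounds for partial sums then pass to the limit on each finite set. It serves both
  the Neumann series and the power series of the model.\<close>

lemma ell2_geometric_series:
  assumes a: "\<And>n. a n \<in> ell2 V" and M: "\<And>n. ell2_norm V (a n) \<le> M * t ^ n"
    and t: "0 \<le> t" "t < 1"
  shows "summable (\<lambda>n. a n v)"
    and "(\<lambda>v. \<Sum>n. a n v) \<in> ell2 V"
    and "ell2_norm V (\<lambda>v. \<Sum>n. a n v) \<le> M / (1 - t)"
    and "ell2_norm V ((\<Sum>n<N. a n) - (\<lambda>v. \<Sum>n. a n v)) \<le> M * t ^ N / (1 - t)"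
proof -
  have geo: "summable (\<lambda>n. M * t ^ n)"
    using t by (intro summable_mult summable_geometric) auto
  have pt: "cmod (a n v) \<le> M * t ^ n" for n v
    using cmod_le_ell2_norm[OF a] M by (meson order_trans)
  have sm: "summable (\<lambda>n. a n v)" for v
    by (rule summable_comparison_test'[OF geo]) (use pt in auto)
  then show "summable (\<lambda>n. a n v)" .
  \<comment> \<open>All tails are treated at once: N = 0 gives membership and the norm bound,
    general N gives the rate of convergence.\<close>
  have tail: "(\<lambda>v. \<Sum>n. a (n + N) v) \<in> ell2 V \<and>
      ell2_norm V (\<lambda>v. \<Sum>n. a (n + N) v) \<le> M * t ^ N / (1 - t)" for N
  proof -
    have fin: "L2_set (\<lambda>v. cmod (\<Sum>n. a (n + N) v)) F \<le> M * t ^ N / (1 - t)"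
      if F: "finite F" "F \<subseteq> V" for F
    proof (rule LIMSEQ_le_const2)
      have "(\<lambda>K. \<Sum>n<K. a (n + N) v) \<longlonglongrightarrow> (\<Sum>n. a (n + N) v)" for v
        using sm by (intro summable_LIMSEQ summable_ignore_initial_segment)
      then show "(\<lambda>K. L2_set (\<lambda>v. cmod (\<Sum>n<K. a (n + N) v)) F)
          \<longlonglongrightarrow> L2_set (\<lambda>v. cmod (\<Sum>n. a (n + N) v)) F"
        unfolding L2_set_def by (intro tendsto_intros)
      have "L2_set (\<lambda>v. cmod (\<Sum>n<K. a (n + N) v)) F \<le> M * t ^ N / (1 - t)" for K
      proof -
        have "L2_set (\<lambda>v. cmod (\<Sum>n<K. a (n + N) v)) F
            = L2_set (\<lambda>v. cmod ((\<Sum>n<K. a (n + N)) v)) F"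
          by (simp add: sum_fun_apply)
        also have "\<dots> \<le> ell2_norm V (\<Sum>n<K. a (n + N))"
          by (intro L2_set_le_ell2_norm ell2_summable[of _ V])
            (use F ell2_sum_norm[of "{..<K}" "\<lambda>n. a (n + N)" V] a in auto)
        also have "\<dots> \<le> (\<Sum>n<K. ell2_norm V (a (n + N)))"
          using ell2_sum_norm[of "{..<K}" "\<lambda>n. a (n + N)" V] a by auto
        also have "\<dots> \<le> (\<Sum>n<K. M * t ^ N * t ^ n)"
        proof (rule sum_mono)
          show "ell2_norm V (a (n + N)) \<le> M * t ^ N * t ^ n" for n
            using M[of "n + N"] by (simp add: power_add mult_ac)
        qed
        also have "\<dots> \<le> (\<Sum>n. M * t ^ N * t ^ n)"
        proof (intro sum_le_suminf summable_mult summable_geometric)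
          show "0 \<le> M * t ^ N * t ^ n" for n
            using order_trans[OF ell2_norm_nonneg M[of "N + n"]] by (simp add: power_add mult_ac)
        qed (use t in auto)
        also have "\<dots> = M * t ^ N / (1 - t)"
          using t by (simp add: suminf_mult summable_geometric suminf_geometric)
        finally show ?thesis .
      qed
      then show "\<exists>N0. \<forall>n\<ge>N0. L2_set (\<lambda>v. cmod (\<Sum>i<n. a (i + N) v)) F \<le> M * t ^ N / (1 - t)"
        by auto
    qed
    show ?thesis
      using ell2_boundI[OF _ fin] by (auto simp: ell2_vanishes[OF a])
  qed
  show "(\<lambda>v. \<Sum>n. a n v) \<in> ell2 V" "ell2_norm V (\<lambda>v. \<Sum>n. a n v) \<le> M / (1 - t)"
    using tail[of 0] by auto
  have "(\<Sum>n<N. a n) - (\<lambda>v. \<Sum>n. a n v) = - (\<lambda>v. \<Sum>n. a (n + N) v)"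
  proof
    fix v
    show "((\<Sum>n<N. a n) - (\<lambda>v. \<Sum>n. a n v)) v = (- (\<lambda>v. \<Sum>n. a (n + N) v)) v"
      using suminf_split_initial_segment[OF sm, of v N] by (simp add: sum_fun_apply)
  qed
  then show "ell2_norm V ((\<Sum>n<N. a n) - (\<lambda>v. \<Sum>n. a n v)) \<le> M * t ^ N / (1 - t)"
    using tail[of N] by (simp add: ell2_norm_uminus)
qed

lemma ell2_limit_unique:
  assumes "\<And>N. a N \<in> ell2 V" "s \<in> ell2 V" "s' \<in> ell2 V"
    and "(\<lambda>N. ell2_norm V (a N - s)) \<longlonglongrightarrow> 0" "(\<lambda>N. ell2_norm V (a N - s')) \<longlonglongrightarrow> 0"
  shows "s = s'"
proof -
  have "(\<lambda>N. ell2_norm V (a N - s) + ell2_norm V (a N - s')) \<longlonglongrightarrow> 0"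
    using tendsto_add[OF assms(4,5)] by simp
  moreover have "ell2_norm V (s' - s) \<le> ell2_norm V (a N - s) + ell2_norm V (a N - s')" for N
    using ell2_diff_norm(2)[of "a N - s" V "a N - s'"] ell2_diff_norm(1) assms(1-3) by force
  ultimately have "ell2_norm V (s' - s) \<le> 0"
    by (intro LIMSEQ_le_const) auto
  then have "s' - s = 0"
    using ell2_norm_eq_0[OF ell2_diff_norm(1)[OF assms(3,2)]] ell2_norm_nonneg by (metis antisym)
  then show ?thesis
    by simp
qed

lemma ell2_suminf_geometric:
  assumes a: "\<And>n. a n \<in> ell2 V" and M: "\<And>n. ell2_norm V (a n) \<le> M * t ^ n"
    and t: "0 \<le> t" "t < 1"
  shows "ell2_suminf V a = (\<lambda>v. \<Sum>n. a n v)"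
  unfolding ell2_suminf_def
proof (rule the_equality)
  note G = ell2_geometric_series[OF a M t]
  have "(\<lambda>N. M * t ^ N / (1 - t)) \<longlonglongrightarrow> M * 0 / (1 - t)"
    by (intro tendsto_intros LIMSEQ_power_zero) (use t in auto)
  then have lim0: "(\<lambda>N. M * t ^ N / (1 - t)) \<longlonglongrightarrow> 0"
    by simp
  have "(\<lambda>N. ell2_norm V ((\<Sum>n<N. a n) - (\<lambda>v. \<Sum>n. a n v))) \<longlonglongrightarrow> 0"
    by (rule Lim_null_comparison[OF always_eventually lim0]) (use G(4) in simp)
  with G(2) show lim: "(\<lambda>v. \<Sum>n. a n v) \<in> ell2 V \<and>
      (\<lambda>N. ell2_norm V ((\<Sum>n<N. a n) - (\<lambda>v. \<Sum>n. a n v))) \<longlonglongrightarrow> 0"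
    by blast
  show "s = (\<lambda>v. \<Sum>n. a n v)"
    if "s \<in> ell2 V \<and> (\<lambda>N. ell2_norm V ((\<Sum>n<N. a n) - s)) \<longlonglongrightarrow> 0" for s
    using ell2_limit_unique[of "\<lambda>N. \<Sum>n<N. a n" V s] lim that ell2_sum_norm[of _ a V] a
    by blast
qed

text \<open>Once the earlier coefficients vanish, the series can be divided by z^n for z \<noteq> 0,
  and the limit at 0 isolates coefficient n.\<close>

lemma powser_zero_coeff:
  fixes a :: "nat \<Rightarrow> complex"
  assumes r: "0 < r" and s: "\<And>z. cmod z < r \<Longrightarrow> (\<lambda>n. a n * z ^ n) sums 0"
  shows "a n = 0"
proof (induction n rule: less_induct)
  case (less n)
  have "(\<lambda>k. a (k + n) * z ^ k) sums 0" if z: "z \<noteq> 0" "cmod z < r" for z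
  proof -
    have "(\<lambda>k. a (k + n) * z ^ (k + n)) sums (0 - (\<Sum>i<n. a i * z ^ i))"
      using s[OF z(2)] by (subst sums_iff_shift) simp
    then have "(\<lambda>k. inverse (z ^ n) * (a (k + n) * z ^ (k + n))) sums (inverse (z ^ n) * 0)"
      using less by (intro sums_mult) simp
    then show ?thesis
      using z by (simp add: power_add field_simps)
  qed
  from powser_limit_0_strong[OF r this] have "((\<lambda>z. 0) \<longlongrightarrow> a (0 + n)) (at (0::complex))"
    by simp
  then show ?case
    by (simp add: tendsto_const_iff)
qed

section \<open>Summation over fibres of a map\<close>

lemma bij_betw_fibers:
  assumes "\<pi> ` A \<subseteq> W"
  shows "bij_betw snd (Sigma W (\<lambda>u. {v \<in> A. \<pi> v = u})) A"
  unfolding bij_betw_def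
proof
  show "inj_on snd (Sigma W (\<lambda>u. {v \<in> A. \<pi> v = u}))"
    by (auto simp: inj_on_def)
  show "snd ` Sigma W (\<lambda>u. {v \<in> A. \<pi> v = u}) = A"
    using assms by (force simp: image_iff)
qed

text \<open>Two maps are used later: \<open>par E\<close>, whose fibres are sets of children, and
  \<open>dp\<close>, whose fibres are the levels.\<close>

lemma infsum_fibers:
  fixes F :: "'a \<Rightarrow> 'c::banach"
  assumes "\<pi> ` A \<subseteq> W" "F summable_on A"
  shows "(\<Sum>\<^sub>\<infinity>u\<in>W. \<Sum>\<^sub>\<infinity>v\<in>{v \<in> A. \<pi> v = u}. F v) = infsum F A"
    and "(\<lambda>u. \<Sum>\<^sub>\<infinity>v\<in>{v \<in> A. \<pi> v = u}. F v) summable_on W"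
proof -
  note bij = bij_betw_fibers[OF assms(1)]
  have s: "(\<lambda>(u, v). F v) summable_on Sigma W (\<lambda>u. {v \<in> A. \<pi> v = u})"
    using summable_on_reindex_bij_betw[OF bij, of F] assms(2) by (simp add: case_prod_unfold)
  show "(\<Sum>\<^sub>\<infinity>u\<in>W. \<Sum>\<^sub>\<infinity>v\<in>{v \<in> A. \<pi> v = u}. F v) = infsum F A"
    using infsum_Sigma'_banach[OF s] infsum_reindex_bij_betw[OF bij, of F]
    by (simp add: case_prod_unfold)
  show "(\<lambda>u. \<Sum>\<^sub>\<infinity>v\<in>{v \<in> A. \<pi> v = u}. F v) summable_on W"
    using summable_on_Sigma_banach[OF s] by simp
qed

lemma summable_on_fibersI:
  fixes F :: "'a \<Rightarrow> real"
  assumes "\<pi> ` A \<subseteq> W" "\<And>v. v \<in> A \<Longrightarrow> 0 \<le> F v"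
    and "\<And>u. u \<in> W \<Longrightarrow> F summable_on {v \<in> A. \<pi> v = u}"
    and "(\<lambda>u. \<Sum>\<^sub>\<infinity>v\<in>{v \<in> A. \<pi> v = u}. F v) summable_on W"
  shows "F summable_on A"
proof -
  note bij = bij_betw_fibers[OF assms(1)]
  have "(\<Sum>\<^sub>\<infinity>v\<in>{v \<in> A. \<pi> v = u}. \<bar>F v\<bar>) = (\<Sum>\<^sub>\<infinity>v\<in>{v \<in> A. \<pi> v = u}. F v)" for u
    by (rule infsum_cong) (use assms(2) in auto)
  then have "(\<lambda>p. norm (case p of (u, v) \<Rightarrow> F v)) summable_on Sigma W (\<lambda>u. {v \<in> A. \<pi> v = u})"
    using assms(3)[THEN summable_on_iff_abs_summable_on_real[THEN iffD1]]
      assms(4)[THEN summable_on_iff_abs_summable_on_real[THEN iffD1]]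
    by (intro Infinite_Sum.abs_summable_on_Sigma_iff[THEN iffD2]) simp
  then have "(\<lambda>(u, v). F v) summable_on Sigma W (\<lambda>u. {v \<in> A. \<pi> v = u})"
    by (rule abs_summable_summable)
  then show ?thesis
    using summable_on_reindex_bij_betw[OF bij, of F] by (simp add: case_prod_unfold)
qed

lemma ell2_subset_iff:
  assumes "W \<subseteq> V"
  shows "f \<in> ell2 W \<longleftrightarrow> f \<in> ell2 V \<and> (\<forall>v\<in>V - W. f v = 0)"
proof -
  have "(\<lambda>v. (cmod (f v))\<^sup>2) summable_on W \<longleftrightarrow> (\<lambda>v. (cmod (f v))\<^sup>2) summable_on V"
    if "\<forall>v\<in>V - W. f v = 0"
    by (rule summable_on_cong_neutral) (use that assms in auto)
  then show ?thesis
    using assms unfolding ell2_def by blast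
qed

lemma ell2_comparison:
  assumes "f \<in> ell2 V" "\<And>v. cmod (g v) \<le> C * cmod (f v)"
  shows "g \<in> ell2 V"
proof -
  have "(\<lambda>v. C\<^sup>2 * (cmod (f v))\<^sup>2) summable_on V"
    using assms(1) by (intro summable_on_cmult_right) (simp add: ell2_def)
  then have "(\<lambda>v. (cmod (g v))\<^sup>2) summable_on V"
  proof (rule summable_on_comparison_test)
    show "(cmod (g v))\<^sup>2 \<le> C\<^sup>2 * (cmod (f v))\<^sup>2" for v
      using power_mono[OF assms(2)[of v] norm_ge_zero, of 2] by (simp add: power_mult_distrib)
  qed auto
  moreover have "g v = 0" if "v \<notin> V" for v
    using assms(2)[of v] ell2_vanishes[OF assms(1) that] by simp
  ultimately show ?thesis
    by (simp add: ell2_def)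
qed

section \<open>Orthonormal bases and weighted sequence spaces\<close>

lemma orthonormal_independent:
  assumes M: "M \<subseteq> ell2 V" and b: "orthonormal_basis V M J b"
  shows "inj_on b J" and "cfun.independent (b ` J)"
proof -
  have on: "ell2_inner V (b i) (b j) = (if i = j then 1 else 0)" if "i \<in> J" "j \<in> J" for i j
    using b that by (simp add: orthonormal_basis_def)
  have bV: "b j \<in> ell2 V" if "j \<in> J" for j
    using b M that by (auto simp: orthonormal_basis_def)
  show "inj_on b J"
  proof (rule inj_onI)
    fix i j assume ij: "i \<in> J" "j \<in> J" "b i = b j"
    then show "i = j"
      using on[OF ij(1,2)] on[OF ij(1,1)] by (metis zero_neq_one)
  qed
  show "cfun.independent (b ` J)"
    unfolding cfun.dependent_explicit
  proof clarify
    fix T u v0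
    assume T: "finite T" "T \<subseteq> b ` J" and z: "(\<Sum>v\<in>T. u v *\<^sub>C v) = 0" and v0: "v0 \<in> T" "u v0 \<noteq> 0"
    have TV: "v \<in> ell2 V" if "v \<in> T" for v
      using that T bV by blast
    have "0 = ell2_inner V (\<Sum>v\<in>T. u v *\<^sub>C v) v0"
      unfolding z by simp
    also have "\<dots> = (\<Sum>v\<in>T. ell2_inner V (u v *\<^sub>C v) v0)"
      by (rule ell2_inner_sum_left) (use TV v0 in \<open>auto intro: ell2_cscale\<close>)
    also have "\<dots> = (\<Sum>v\<in>T. if v = v0 then u v0 else 0)"
    proof (rule sum.cong[OF refl])
      fix v assume "v \<in> T"
      then obtain i j where "i \<in> J" "v = b i" "j \<in> J" "v0 = b j"
        using T v0 by blast
      then show "ell2_inner V (u v *\<^sub>C v) v0 = (if v = v0 then u v0 else 0)"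
        using on[of i j] on[of j j] by (auto simp: ell2_inner_cscale_left split: if_splits)
    qed
    also have "\<dots> = u v0"
      using T v0 by simp
    finally show False
      using v0 by simp
  qed
qed

text \<open>Independence bounds the number of basis vectors, and injectivity of b transfers this to
  the index set. A finite J makes every later expansion a finite sum.\<close>

lemma orthonormal_basis_finite:
  assumes "M \<subseteq> ell2 V" "orthonormal_basis V M J b" "finite_dimensional M"
  shows "finite J"
proof -
  obtain B where B: "finite B" "M \<subseteq> cfun.span B"
    using assms(3) by (auto simp: finite_dimensional_def)
  have "b ` J \<subseteq> M"
    using assms(2) by (auto simp: orthonormal_basis_def)
  then have "finite (b ` J)"
    using cfun.independent_span_bound[OF B(1) orthonormal_independent(2)[OF assms(1,2)]] B(2) by blast
  then show ?thesis
    using finite_imageD orthonormal_independent(1)[OF assms(1,2)] by blast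
qed

text \<open>The definition provides only density of the span. The finite Fourier sum p is the best
  approximation of f from the span: f - p is orthogonal to every g there, so the squared norm of f -
  p equals the inner product of f - g with f - p. A strictly closer g would contradict
  Cauchy-Schwarz.\<close>

lemma orthonormal_basis_expansion:
  assumes M: "M \<subseteq> ell2 V" and b: "orthonormal_basis V M J b" and J: "finite J" and f: "f \<in> M"
  shows "f = (\<Sum>j\<in>J. ell2_inner V f (b j) *\<^sub>C b j)"
proof -
  have on: "ell2_inner V (b i) (b j) = (if i = j then 1 else 0)" if "i \<in> J" "j \<in> J" for i j
    using b that by (simp add: orthonormal_basis_def)
  have bV: "b j \<in> ell2 V" if "j \<in> J" for j
    using b M that by (auto simp: orthonormal_basis_def)
  have fV: "f \<in> ell2 V"
    using f M by blast
  define p where "p = (\<Sum>j\<in>J. ell2_inner V f (b j) *\<^sub>C b j)"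
  have pV: "p \<in> ell2 V"
    unfolding p_def by (rule ell2_sum_norm[THEN conjunct1]) (rule ell2_cscale[OF bV])
  have p_span: "p \<in> cfun.span (b ` J)"
    unfolding p_def by (intro cfun.span_sum cfun.span_scale cfun.span_base imageI)
  have dV: "f - p \<in> ell2 V"
    by (rule ell2_diff_norm(1)[OF fV pV])
  have "ell2_inner V p (b i) = ell2_inner V f (b i)" if i: "i \<in> J" for i
  proof -
    have "ell2_inner V p (b i) = (\<Sum>j\<in>J. ell2_inner V (ell2_inner V f (b j) *\<^sub>C b j) (b i))"
      unfolding p_def by (rule ell2_inner_sum_left) (use bV i in \<open>auto intro: ell2_cscale\<close>)
    also have "\<dots> = (\<Sum>j\<in>J. if j = i then ell2_inner V f (b i) else 0)"
      by (rule sum.cong[OF refl]) (simp add: ell2_inner_cscale_left on i)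
    also have "\<dots> = ell2_inner V f (b i)"
      using i J by simp
    finally show ?thesis .
  qed
  then have orth: "ell2_inner V (b i) (f - p) = 0" if "i \<in> J" for i
    using ell2_inner_diff_right[OF fV pV bV[OF that]] that
      ell2_inner_commute[of V "b i" f] ell2_inner_commute[of V "b i" p] by simp
  have span: "g \<in> ell2 V \<and> ell2_inner V g (f - p) = 0" if "g \<in> cfun.span (b ` J)" for g
    using that
  proof (induction rule: cfun.span_induct)
    case base
    show ?case
      unfolding cfun.subspace_def
      by (auto simp only: mem_Collect_eq ell2_inner_cscale_left ell2_cscale ell2_add_norm(1)
          ell2_inner_add_left[OF _ _ dV] ell2_zero ell2_inner_zero_left add_0 mult_zero_right)
  next
    case (step g)
    then show ?case
      using bV orth by blast
  qed
  have "f - p = 0"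
  proof (rule ccontr)
    assume "f - p \<noteq> 0"
    then have n: "0 < ell2_norm V (f - p)"
      using ell2_norm_eq_0[OF dV] ell2_norm_nonneg[of V "f - p"] by linarith
    then obtain g where g: "g \<in> cfun.span (b ` J)" "ell2_norm V (f - g) < ell2_norm V (f - p)"
      using b f unfolding orthonormal_basis_def by blast
    have gV: "g \<in> ell2 V"
      using span g by blast
    have "ell2_inner V (f - g) (f - p) = ell2_inner V f (f - p)"
      using ell2_inner_diff_left[OF fV gV dV] span[OF g(1)] by simp
    moreover have "ell2_inner V (f - p) (f - p) = ell2_inner V f (f - p)"
      using ell2_inner_diff_left[OF fV pV dV] span[OF p_span] by simp
    ultimately have "complex_of_real ((ell2_norm V (f - p))\<^sup>2) = ell2_inner V (f - g) (f - p)"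
      unfolding ell2_inner_self[OF dV, symmetric] by simp
    then have "(ell2_norm V (f - p))\<^sup>2 = cmod (ell2_inner V (f - g) (f - p))"
      by (metis norm_of_real abs_power2)
    also have "\<dots> \<le> ell2_norm V (f - g) * ell2_norm V (f - p)"
      by (rule ell2_cauchy_schwarz[OF ell2_diff_norm(1)[OF fV gV] dV])
    also have "\<dots> < ell2_norm V (f - p) * ell2_norm V (f - p)"
      using g(2) n by (intro mult_strict_right_mono)
    finally show False
      by (simp add: power2_eq_square)
  qed
  then show ?thesis
    by (simp add: p_def)
qed

section \<open>Weighted sequence spaces\<close>

lemma weighted_ell2_zero: "(\<lambda>n. 0) \<in> weighted_ell2 \<beta>"
  by (simp add: weighted_ell2_def)

lemma weighted_ell2_add:
  assumes \<beta>: "\<And>n. 0 \<le> \<beta> n" and a: "a \<in> weighted_ell2 \<beta>" "c \<in> weighted_ell2 \<beta>"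
  shows "(\<lambda>n. a n + c n) \<in> weighted_ell2 \<beta>"
proof -
  have "summable (\<lambda>n. 2 * ((cmod (a n))\<^sup>2 * \<beta> n) + 2 * ((cmod (c n))\<^sup>2 * \<beta> n))"
    using a unfolding weighted_ell2_def by (intro summable_add summable_mult) auto
  moreover have "norm ((cmod (a n + c n))\<^sup>2 * \<beta> n) \<le>
      2 * ((cmod (a n))\<^sup>2 * \<beta> n) + 2 * ((cmod (c n))\<^sup>2 * \<beta> n)" for n
  proof -
    have "(cmod (a n + c n))\<^sup>2 \<le> (cmod (a n) + cmod (c n))\<^sup>2"
      by (intro power_mono norm_triangle_ineq norm_ge_zero)
    also have "\<dots> \<le> 2 * (cmod (a n))\<^sup>2 + 2 * (cmod (c n))\<^sup>2"
      using sum_squares_bound[of "cmod (a n)" "cmod (c n)"] by (simp add: power2_sum)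
    finally show ?thesis
      using mult_right_mono[OF _ \<beta>[of n]] \<beta>[of n] by (fastforce simp: abs_mult algebra_simps)
  qed
  ultimately have "summable (\<lambda>n. (cmod (a n + c n))\<^sup>2 * \<beta> n)"
    by (rule summable_comparison_test'[where N = 0])
  then show ?thesis
    by (simp add: weighted_ell2_def)
qed

lemma weighted_ell2_sum:
  assumes "\<And>n. 0 \<le> \<beta> n" "\<And>i. i \<in> I \<Longrightarrow> a i \<in> weighted_ell2 \<beta>"
  shows "(\<lambda>n. \<Sum>i\<in>I. a i n) \<in> weighted_ell2 \<beta>"
  using assms(2)
proof (induction I rule: infinite_finite_induct)
  case (insert i I)
  then show ?case
    using weighted_ell2_add[OF assms(1), where a = "a i" and c = "\<lambda>n. \<Sum>i\<in>I. a i n"] by simp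
qed (simp_all add: weighted_ell2_zero)

section \<open>Balanced weighted shifts and their adjoints\<close>

locale balanced_tree_shift =
  fixes V :: "'v set" and E :: "('v \<times> 'v) set" and lam :: "'v \<Rightarrow> real"
  assumes tree: "rooted_directed_tree V E"
    and leafless: "leafless V E"
    and bounded: "bounded_operator V (ell2 V) (weighted_shift V E lam)"
    and balanced: "balanced V E lam"
    and left_invertible: "left_invertible V (weighted_shift V E lam)"
begin

abbreviation rt :: 'v where "rt \<equiv> tree_root V E"
abbreviation dp :: "'v \<Rightarrow> nat" where "dp \<equiv> depth V E"
abbreviation lev :: "nat \<Rightarrow> 'v set" where "lev \<equiv> level V E"
abbreviation S :: "('v \<Rightarrow> complex) \<Rightarrow> 'v \<Rightarrow> complex" where "S \<equiv> weighted_shift V E lam"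

definition children :: "'v \<Rightarrow> 'v set"
  where "children u = {v \<in> V - {rt}. par E v = u}"

section \<open>Parents, depth and children in the tree\<close>

lemma root_unique: "\<exists>!r. r \<in> V \<and> (\<forall>u. (u, r) \<notin> E)"
  using tree by (simp add: rooted_directed_tree_def)

lemma root_in: "rt \<in> V" and root_no_edge: "(u, rt) \<notin> E"
  using theI'[OF root_unique] by (auto simp: tree_root_def)

lemma edge_par: "(u, v) \<in> E \<Longrightarrow> u \<in> V \<and> v \<in> V - {rt} \<and> par E v = u"
  using tree root_no_edge unfolding rooted_directed_tree_def par_def by (blast intro!: the1_equality)

lemma par_edge:
  assumes "v \<in> V - {rt}"
  shows "(par E v, v) \<in> E"
proof -
  obtain u where "(u, v) \<in> E"
    using assms root_unique root_in root_no_edge by blast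
  with edge_par[OF this] show ?thesis
    by simp
qed

lemma par_in: "v \<in> V - {rt} \<Longrightarrow> par E v \<in> V"
  using par_edge edge_par by blast

text \<open>Paths are compared from their last edge backwards: the parent is unique, and since no
  edge enters the root, an empty path cannot be matched with a nonempty one.\<close>

lemma path_length_unique: "(rt, v) \<in> E ^^ k \<Longrightarrow> (rt, v) \<in> E ^^ m \<Longrightarrow> k = m"
proof (induction k arbitrary: v m)
  case 0
  then show ?case
    using root_no_edge by (cases m) auto
next
  case (Suc k)
  then obtain x where x: "(rt, x) \<in> E ^^ k" "(x, v) \<in> E"
    by auto
  then obtain m' where m': "m = Suc m'"
    using Suc.prems(2) root_no_edge by (cases m) auto
  then obtain y where "(rt, y) \<in> E ^^ m'" "(y, v) \<in> E"
    using Suc.prems(2) by auto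
  then show ?case
    using Suc.IH x m' edge_par by metis
qed

lemma depth_eqI: "(rt, v) \<in> E ^^ k \<Longrightarrow> dp v = k"
  unfolding depth_def using path_length_unique by blast

lemma depth_path:
  assumes "v \<in> V"
  shows "(rt, v) \<in> E ^^ dp v"
proof -
  have "(rt, v) \<in> E\<^sup>*"
    using tree root_in root_no_edge assms unfolding rooted_directed_tree_def by blast
  then obtain k where "(rt, v) \<in> E ^^ k"
    using rtrancl_imp_relpow by blast
  with depth_eqI[OF this] show ?thesis
    by simp
qed

lemma depth_root: "dp rt = 0"
  by (rule depth_eqI) simp

lemma depth_par: "v \<in> V - {rt} \<Longrightarrow> dp v = Suc (dp (par E v))"
  using depth_path[OF par_in] par_edge by (intro depth_eqI) auto

text \<open>Leaflessness enters here. With every level nonempty, each \<open>q k\<close> is the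
  squared norm belonging to an actual vertex, so bounds on \<open>q\<close> hold for all k.\<close>

lemma ex_depth: "\<exists>u\<in>V. dp u = k"
proof (induction k)
  case 0
  then show ?case
    using root_in depth_root by blast
next
  case (Suc k)
  then obtain u w where "u \<in> V" "dp u = k" "(u, w) \<in> E"
    using leafless unfolding leafless_def by blast
  then show ?case
    using edge_par depth_par by blast
qed

lemma children_subset: "children u \<subseteq> V"
  by (auto simp: children_def)

lemma children_outside: "u \<notin> V \<Longrightarrow> children u = {}"
  using par_in by (auto simp: children_def)

lemma depth_child: "v \<in> children u \<Longrightarrow> dp v = Suc (dp u)"
  using depth_par by (auto simp: children_def)

text \<open>By balancedness the chosen vertex is immaterial, see \<open>q_depth\<close>; the choice
  only serves to make this a function of the depth.\<close>

definition q :: "nat \<Rightarrow> real"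
  where "q k = (ell2_norm V (S (unit_vec (SOME u. u \<in> V \<and> dp u = k))))\<^sup>2"

lemma q_depth:
  assumes "u \<in> V"
  shows "q (dp u) = (ell2_norm V (S (unit_vec u)))\<^sup>2"
proof -
  have "\<exists>w. w \<in> V \<and> dp w = dp u"
    using assms by blast
  from someI_ex[OF this] show ?thesis
    using balanced assms unfolding q_def balanced_def by metis
qed

lemma S_ell2: "f \<in> ell2 V \<Longrightarrow> S f \<in> ell2 V"
  using bounded by (simp add: bounded_operator_def)

lemma S_add: "S (f + g) = S f + S g"
  by (auto simp: weighted_shift_def fun_eq_iff algebra_simps)

lemma S_bound: "\<exists>C>0. \<forall>f\<in>ell2 V. ell2_norm V (S f) \<le> C * ell2_norm V f"
proof -
  obtain C where C: "\<And>f. f \<in> ell2 V \<Longrightarrow> ell2_norm V (S f) \<le> C * ell2_norm V f"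
    using bounded unfolding bounded_operator_def by blast
  have "ell2_norm V (S f) \<le> (\<bar>C\<bar> + 1) * ell2_norm V f" if "f \<in> ell2 V" for f
    using C[OF that] by (rule order_trans) (intro mult_right_mono; simp)
  then show ?thesis
    by (intro exI[of _ "\<bar>C\<bar> + 1"]) simp
qed

text \<open>The upper bound is the squared norm bound of \<open>S\<close>. For the lower one, a left
  inverse B with bound A gives 1 = norm of B (S e) \<le> A times the norm of S e for every unit
  vector e at a vertex.\<close>

lemma q_bounds: "\<exists>\<delta> C. 0 < \<delta> \<and> 0 < C \<and> (\<forall>k. \<delta> \<le> q k \<and> q k \<le> C)"
proof -
  obtain C where C: "0 < C" "\<And>f. f \<in> ell2 V \<Longrightarrow> ell2_norm V (S f) \<le> C * ell2_norm V f"
    using S_bound by blast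
  obtain B A where B: "\<And>f. f \<in> ell2 V \<Longrightarrow> B (S f) = f"
    and A: "\<And>f. f \<in> ell2 V \<Longrightarrow> ell2_norm V (B f) \<le> A * ell2_norm V f"
    using left_invertible unfolding left_invertible_def bounded_operator_def by blast
  have *: "1 / A\<^sup>2 \<le> q k" "0 < A" "q k \<le> C\<^sup>2" for k
  proof -
    obtain u where u: "u \<in> V" "dp u = k"
      using ex_depth by blast
    have 1: "1 \<le> A * ell2_norm V (S (unit_vec u))"
      using A[OF S_ell2[OF unit_vec_ell2[OF u(1)]]] B[OF unit_vec_ell2[OF u(1)]]
      by (simp add: ell2_norm_unit_vec u)
    then show "0 < A"
      using ell2_norm_nonneg[of V "S (unit_vec u)"]
      by (smt (verit) mult_nonneg_nonneg mult_minus_left zero_less_mult_iff)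
    have "1 / A \<le> ell2_norm V (S (unit_vec u))"
      using 1 \<open>0 < A\<close> by (simp add: field_simps)
    from power_mono[OF this, of 2] \<open>0 < A\<close> show "1 / A\<^sup>2 \<le> q k"
      using q_depth[OF u(1)] u(2) by (simp add: power_divide)
    have "ell2_norm V (S (unit_vec u)) \<le> C"
      using C(2)[OF unit_vec_ell2[OF u(1)]] by (simp add: ell2_norm_unit_vec u)
    from power_mono[OF this, of 2] show "q k \<le> C\<^sup>2"
      using q_depth[OF u(1)] u(2) by simp
  qed
  then show ?thesis
    using C(1) by (intro exI[of _ "1 / A\<^sup>2"] exI[of _ "C\<^sup>2"]) simp
qed

lemma q_pos: "0 < q k"
  using q_bounds by (meson less_le_trans)

lemma S_unit_vec: "S (unit_vec u) v = (if v \<in> children u then complex_of_real (lam v) else 0)"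
  by (auto simp: weighted_shift_def unit_vec_def children_def)

lemma lam_children:
  assumes "u \<in> V"
  shows "(\<lambda>v. (cmod (complex_of_real (lam v)))\<^sup>2) summable_on children u"
    and "(\<Sum>\<^sub>\<infinity>v\<in>children u. (cmod (complex_of_real (lam v)))\<^sup>2) = q (dp u)"
    and "ell2_norm (children u) (\<lambda>v. complex_of_real (lam v)) = sqrt (q (dp u))"
proof -
  have "S (unit_vec u) \<in> ell2 V"
    by (intro S_ell2 unit_vec_ell2 assms)
  moreover have "(\<lambda>v. (cmod (S (unit_vec u) v))\<^sup>2) summable_on V \<longleftrightarrow>
      (\<lambda>v. (cmod (complex_of_real (lam v)))\<^sup>2) summable_on children u"
    by (rule summable_on_cong_neutral) (use children_subset in \<open>auto simp: S_unit_vec\<close>)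
  ultimately show "(\<lambda>v. (cmod (complex_of_real (lam v)))\<^sup>2) summable_on children u"
    by (simp add: ell2_def)
  have "(\<Sum>\<^sub>\<infinity>v\<in>V. (cmod (S (unit_vec u) v))\<^sup>2) =
      (\<Sum>\<^sub>\<infinity>v\<in>children u. (cmod (complex_of_real (lam v)))\<^sup>2)"
    by (rule infsum_cong_neutral) (use children_subset in \<open>auto simp: S_unit_vec\<close>)
  then show "(\<Sum>\<^sub>\<infinity>v\<in>children u. (cmod (complex_of_real (lam v)))\<^sup>2) = q (dp u)"
    using q_depth[OF assms] by (simp add: ell2_norm_power2)
  then show "ell2_norm (children u) (\<lambda>v. complex_of_real (lam v)) = sqrt (q (dp u))"
    by (simp add: ell2_norm_def)
qed

text \<open>\<open>D\<close> is the adjoint \<open>S\<^sup>*\<close>, and \<open>L = (S\<^sup>* S)\<^sup>-\<^sup>1 S\<^sup>*\<close> below: by balancedness, \<open>S\<^sup>* S\<close> is multiplication by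
  \<open>q (dp u)\<close>.\<close>

definition D :: "('v \<Rightarrow> complex) \<Rightarrow> 'v \<Rightarrow> complex"
  where "D g u = (\<Sum>\<^sub>\<infinity>v\<in>children u. complex_of_real (lam v) * g v)"

lemma D_outside: "u \<notin> V \<Longrightarrow> D g u = 0"
  by (simp add: D_def children_outside)

lemma D_summable:
  assumes "g \<in> ell2 V"
  shows "(\<lambda>v. complex_of_real (lam v) * g v) summable_on children u"
proof (cases "u \<in> V")
  case True
  show ?thesis
    by (rule abs_summable_summable[OF cauchy_schwarz_summable(1)[OF lam_children(1)[OF True]]])
      (rule ell2_summable[OF assms children_subset])
qed (simp add: children_outside)

lemma D_bound:
  assumes "g \<in> ell2 V" "u \<in> V"
  shows "cmod (D g u) \<le> sqrt (q (dp u)) * ell2_norm (children u) g"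
  using cauchy_schwarz_summable(2)[OF lam_children(1)[OF assms(2)] ell2_summable[OF assms(1) children_subset]]
  by (simp add: D_def lam_children(3)[OF assms(2)])

lemma D_add: "f \<in> ell2 V \<Longrightarrow> g \<in> ell2 V \<Longrightarrow> D (f + g) = D f + D g"
  by (rule ext) (simp add: D_def distrib_left infsum_add D_summable)

lemma D_cscale: "D (c *\<^sub>C f) = c *\<^sub>C D f"
  by (rule ext) (simp add: D_def cscale_def mult.left_commute infsum_cmult_right')

lemma D_diff:
  assumes "f \<in> ell2 V" "g \<in> ell2 V"
  shows "D (f - g) = D f - D g"
proof -
  have "D (f + (-1) *\<^sub>C g) = D f + (-1) *\<^sub>C D g"
    using D_add[OF assms(1) ell2_cscale[OF assms(2)], of "-1"] by (simp only: D_cscale)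
  then show ?thesis
    by (simp add: cscale_minus1)
qed

lemma D_S: "D (S f) u = (if u \<in> V then complex_of_real (q (dp u)) * f u else 0)"
proof (cases "u \<in> V")
  case True
  have "((\<lambda>v. complex_of_real ((cmod (complex_of_real (lam v)))\<^sup>2)) has_sum complex_of_real (q (dp u))) (children u)"
    unfolding lam_children(2)[OF True, symmetric]
    by (intro has_sum_of_real has_sum_infsum lam_children(1)[OF True])
  then have "((\<lambda>v. complex_of_real ((cmod (complex_of_real (lam v)))\<^sup>2) * f u) has_sum
      (complex_of_real (q (dp u)) * f u)) (children u)"
    by (rule has_sum_cmult_left)
  moreover have "D (S f) u =
      (\<Sum>\<^sub>\<infinity>v\<in>children u. complex_of_real ((cmod (complex_of_real (lam v)))\<^sup>2) * f u)"
    unfolding D_def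
    by (rule infsum_cong) (auto simp: weighted_shift_def children_def power2_eq_square
        simp flip: of_real_mult)
  ultimately show ?thesis
    using True infsumI by metis
qed (simp add: D_outside)

definition L :: "('v \<Rightarrow> complex) \<Rightarrow> 'v \<Rightarrow> complex"
  where "L g u = D g u / complex_of_real (q (dp u))"

lemma D_eq_L: "D g u = complex_of_real (q (dp u)) * L g u"
  using q_pos[of "dp u"] by (simp add: L_def)

lemma L_add: "f \<in> ell2 V \<Longrightarrow> g \<in> ell2 V \<Longrightarrow> L (f + g) = L f + L g"
  by (rule ext) (simp add: L_def D_add add_divide_distrib)

lemma L_diff: "f \<in> ell2 V \<Longrightarrow> g \<in> ell2 V \<Longrightarrow> L (f - g) = L f - L g"
  by (rule ext) (simp add: L_def D_diff diff_divide_distrib)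

lemma L_cscale: "L (c *\<^sub>C f) = c *\<^sub>C L f"
  by (rule ext) (simp only: L_def D_cscale, simp add: cscale_def L_def)

lemma L_S: "f \<in> ell2 V \<Longrightarrow> L (S f) = f"
  using q_pos by (intro ext) (simp add: L_def D_S ell2_vanishes less_imp_neq[symmetric])

lemma S_0: "S 0 = 0" and L_0: "L 0 = 0"
  by (auto simp: weighted_shift_def L_def D_def fun_eq_iff)

section \<open>Norm estimates for \<open>L\<close> and its powers\<close>

lemma children_fiber:
  "u \<in> W \<Longrightarrow> {v \<in> {v \<in> V - {rt}. par E v \<in> W}. par E v = u} = children u"
  by (auto simp: children_def)

text \<open>Cauchy-Schwarz over the children of u costs a factor q (dp u), and division by its
  square in \<open>L\<close> leaves 1 / q (dp u). The general set W allows two uses: all of V with a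
  uniform lower bound, and one level with its exact value of \<open>q\<close>.\<close>

lemma L_norm_on:
  assumes f: "f \<in> ell2 V" and W: "W \<subseteq> V" and c: "0 < c" "\<And>u. u \<in> W \<Longrightarrow> c \<le> q (dp u)"
  shows "(\<lambda>u. (cmod (L f u))\<^sup>2) summable_on W"
    and "(ell2_norm W (L f))\<^sup>2 \<le> (ell2_norm {v \<in> V - {rt}. par E v \<in> W} f)\<^sup>2 / c"
proof -
  let ?A = "{v \<in> V - {rt}. par E v \<in> W}"
  let ?N = "\<lambda>u. (ell2_norm (children u) f)\<^sup>2"
  have im: "par E ` ?A \<subseteq> W"
    by auto
  have sA: "(\<lambda>v. (cmod (f v))\<^sup>2) summable_on ?A"
    by (rule ell2_summable[OF f]) auto
  have fib: "(\<Sum>\<^sub>\<infinity>v\<in>{v \<in> ?A. par E v = u}. (cmod (f v))\<^sup>2) = ?N u" if "u \<in> W" for u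
    by (simp only: children_fiber[OF that] ell2_norm_power2)
  have sN: "?N summable_on W"
    using infsum_fibers(2)[OF im sA] fib by (simp cong: summable_on_cong)
  have eqN: "(\<Sum>\<^sub>\<infinity>u\<in>W. ?N u) = (ell2_norm ?A f)\<^sup>2"
  proof -
    have "(\<Sum>\<^sub>\<infinity>u\<in>W. ?N u) = (\<Sum>\<^sub>\<infinity>u\<in>W. \<Sum>\<^sub>\<infinity>v\<in>{v \<in> ?A. par E v = u}. (cmod (f v))\<^sup>2)"
      by (rule infsum_cong) (rule fib[symmetric])
    also have "\<dots> = (ell2_norm ?A f)\<^sup>2"
      unfolding ell2_norm_power2[of ?A] by (rule infsum_fibers(1)[OF im sA])
    finally show ?thesis .
  qed
  have le: "(cmod (L f u))\<^sup>2 \<le> ?N u * inverse c" if u: "u \<in> W" for u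
  proof -
    have uV: "u \<in> V"
      using u W by blast
    have "(cmod (D f u))\<^sup>2 \<le> q (dp u) * ?N u"
      using power_mono[OF D_bound[OF f uV] norm_ge_zero, of 2] q_pos[of "dp u"]
      by (simp add: power_mult_distrib)
    then have "(cmod (L f u))\<^sup>2 \<le> ?N u * inverse (q (dp u))"
      using q_pos[of "dp u"] by (simp add: L_def norm_divide power_divide field_simps power2_eq_square)
    also have "\<dots> \<le> ?N u * inverse c"
      using c u by (intro mult_left_mono le_imp_inverse_le) auto
    finally show ?thesis .
  qed
  have sN': "(\<lambda>u. ?N u * inverse c) summable_on W"
    by (intro summable_on_cmult_left sN)
  show s: "(\<lambda>u. (cmod (L f u))\<^sup>2) summable_on W"
    by (rule summable_on_comparison_test[OF sN']) (use le in auto)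
  have "(ell2_norm W (L f))\<^sup>2 \<le> (\<Sum>\<^sub>\<infinity>u\<in>W. ?N u * inverse c)"
    unfolding ell2_norm_power2[of W] by (rule infsum_mono[OF s sN' le])
  also have "\<dots> = (ell2_norm ?A f)\<^sup>2 / c"
    by (simp add: infsum_cmult_left' eqN divide_inverse)
  finally show "(ell2_norm W (L f))\<^sup>2 \<le> (ell2_norm ?A f)\<^sup>2 / c" .
qed

lemma ell2_norm_subset:
  assumes "f \<in> ell2 V" "W \<subseteq> V"
  shows "ell2_norm W f \<le> ell2_norm V f"
  unfolding ell2_norm_def
  by (intro real_sqrt_le_mono infsum_mono2) (use assms ell2_summable in auto)

lemma L_ell2:
  assumes "f \<in> ell2 V"
  shows "L f \<in> ell2 V"
proof -
  obtain \<delta> where "0 < \<delta>" "\<And>k. \<delta> \<le> q k"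
    using q_bounds by metis
  then show ?thesis
    using L_norm_on(1)[OF assms subset_refl, of \<delta>] by (simp add: ell2_def L_def D_outside)
qed

lemma L_bound: "\<exists>A>0. \<forall>f\<in>ell2 V. ell2_norm V (L f) \<le> A * ell2_norm V f"
proof -
  obtain \<delta> where d: "0 < \<delta>" "\<And>k. \<delta> \<le> q k"
    using q_bounds by metis
  have "ell2_norm V (L f) \<le> (1 / sqrt \<delta>) * ell2_norm V f" if f: "f \<in> ell2 V" for f
  proof (rule power2_le_imp_le)
    have "(ell2_norm V (L f))\<^sup>2 \<le> (ell2_norm {v \<in> V - {rt}. par E v \<in> V} f)\<^sup>2 / \<delta>"
      using L_norm_on(2)[OF f subset_refl] d by blast
    also have "\<dots> \<le> (ell2_norm V f)\<^sup>2 / \<delta>"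
      by (intro divide_right_mono power_mono ell2_norm_subset[OF f]) (use d in auto)
    finally show "(ell2_norm V (L f))\<^sup>2 \<le> (1 / sqrt \<delta> * ell2_norm V f)\<^sup>2"
      using d by (simp add: power_mult_distrib power_divide)
  qed (use d in simp)
  then show ?thesis
    using d(1) by (intro exI[of _ "1 / sqrt \<delta>"]) simp
qed

lemma L_pow_ell2: "f \<in> ell2 V \<Longrightarrow> (L ^^ n) f \<in> ell2 V"
  by (induction n) (auto simp: L_ell2)

lemma S_pow_ell2: "f \<in> ell2 V \<Longrightarrow> (S ^^ n) f \<in> ell2 V"
  by (induction n) (auto simp: S_ell2)

lemma D_ell2:
  assumes "f \<in> ell2 V"
  shows "D f \<in> ell2 V"
proof -
  obtain C where C: "\<And>k. q k \<le> C"
    using q_bounds by metis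
  have "cmod (D f v) \<le> C * cmod (L f v)" for v
    using C[of "dp v"] q_pos[of "dp v"] by (simp add: D_eq_L norm_mult mult_right_mono)
  then show ?thesis
    by (rule ell2_comparison[OF L_ell2[OF assms]])
qed

text \<open>\<open>S f\<close> vanishes at the root, so the inner product is a sum over the other
  vertices. Grouped by parent, the factor f (par E v) is constant on each group and can be pulled
  out.\<close>

lemma S_adjoint:
  assumes f: "f \<in> ell2 V" and g: "g \<in> ell2 V"
  shows "ell2_inner V (S f) g = ell2_inner V f (D g)"
proof -
  let ?A = "{v \<in> V - {rt}. par E v \<in> V}"
  let ?F = "\<lambda>v. S f v * cnj (g v)"
  have im: "par E ` ?A \<subseteq> V"
    by auto
  have AV: "?A = V - {rt}"
    using par_in by auto
  have S0: "S f rt = 0"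
    by (simp add: weighted_shift_def)
  have "?F summable_on V"
    by (rule ell2_inner_summable[OF S_ell2[OF f] g])
  then have s: "?F summable_on ?A"
    by (rule summable_on_subset_banach) auto
  have "ell2_inner V (S f) g = infsum ?F ?A"
    unfolding ell2_inner_def by (rule infsum_cong_neutral) (use S0 AV in auto)
  also have "\<dots> = (\<Sum>\<^sub>\<infinity>u\<in>V. \<Sum>\<^sub>\<infinity>v\<in>{v \<in> ?A. par E v = u}. ?F v)"
    by (rule infsum_fibers(1)[OF im s, symmetric])
  also have "\<dots> = (\<Sum>\<^sub>\<infinity>u\<in>V. f u * cnj (D g u))"
  proof (rule infsum_cong)
    fix u assume u: "u \<in> V"
    have "(\<Sum>\<^sub>\<infinity>v\<in>{v \<in> ?A. par E v = u}. ?F v) =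
        (\<Sum>\<^sub>\<infinity>v\<in>children u. f u * cnj (complex_of_real (lam v) * g v))"
      unfolding children_fiber[OF u]
      by (rule infsum_cong) (auto simp: weighted_shift_def children_def)
    also have "\<dots> = f u * (\<Sum>\<^sub>\<infinity>v\<in>children u. cnj (complex_of_real (lam v) * g v))"
      by (rule infsum_cmult_right')
    also have "\<dots> = f u * cnj (D g u)"
      unfolding D_def infsum_cnj ..
    finally show "(\<Sum>\<^sub>\<infinity>v\<in>{v \<in> ?A. par E v = u}. ?F v) = f u * cnj (D g u)" .
  qed
  finally show ?thesis
    by (simp add: ell2_inner_def)
qed

section \<open>Explicit forms of the adjoint, the left inverse and the projection\<close>

lemma adj_S:
  assumes g: "g \<in> ell2 V"
  shows "adj V S g = D g"
  unfolding adj_def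
proof (rule the_equality)
  show "D g \<in> ell2 V \<and> (\<forall>f\<in>ell2 V. ell2_inner V (S f) g = ell2_inner V f (D g))"
    using S_adjoint[OF _ g] D_ell2[OF g] by blast
next
  fix h assume h: "h \<in> ell2 V \<and> (\<forall>f\<in>ell2 V. ell2_inner V (S f) g = ell2_inner V f h)"
  \<comment> \<open>The difference of two candidates is itself an admissible test vector.\<close>
  have hd: "h - D g \<in> ell2 V"
    using h D_ell2[OF g] ell2_diff_norm by blast
  have "ell2_inner V (h - D g) (h - D g) = 0"
    using h S_adjoint[OF hd g] hd D_ell2[OF g] ell2_inner_diff_right[of h V "D g" "h - D g"] by simp
  then have "h - D g = 0"
    using ell2_inner_self_eq_0[OF hd] by blast
  then show "h = D g"
    by simp
qed

lemma ker_adj_S: "ker_adj V S = {f \<in> ell2 V. D f = 0}"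
  by (auto simp: ker_adj_def adj_S)

text \<open>The inverse image taken in \<open>left_inv\<close> is unique because \<open>L\<close>
  inverts \<open>S\<close> from the left, and L f is such an inverse image because D S L =
  D.\<close>

lemma left_inv_S:
  assumes f: "f \<in> ell2 V"
  shows "left_inv V S f = L f"
  unfolding left_inv_def
proof (rule inv_into_f_eq)
  show "inj_on (\<lambda>g. adj V S (S g)) (ell2 V)"
  proof (rule inj_onI)
    fix g h assume gh: "g \<in> ell2 V" "h \<in> ell2 V" "adj V S (S g) = adj V S (S h)"
    then have "L (S g) = L (S h)"
      by (simp add: adj_S S_ell2 L_def fun_eq_iff)
    then show "g = h"
      using gh by (simp add: L_S)
  qed
  show "L f \<in> ell2 V"
    by (rule L_ell2[OF f])
  show "adj V S (S (L f)) = adj V S f"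
    using f by (auto simp: adj_S L_ell2 S_ell2 D_S D_outside fun_eq_iff simp flip: D_eq_L)
qed

lemma left_inv_S_pow: "f \<in> ell2 V \<Longrightarrow> (left_inv V S ^^ n) f = (L ^^ n) f"
  by (induction n) (auto simp: left_inv_S L_pow_ell2)

lemma ker_orthogonal_S: "f \<in> ell2 V \<Longrightarrow> h \<in> ker_adj V S \<Longrightarrow> ell2_inner V (S f) h = 0"
  using S_adjoint[of f h] ell2_inner_commute[of V f 0] by (simp add: ker_adj_S)

text \<open>S L is the orthogonal projection onto the range of \<open>S\<close>: D S L = D puts f -
  S (L f) into the kernel of the adjoint, to which the range of \<open>S\<close> is
  orthogonal.\<close>

lemma proj_ker:
  assumes f: "f \<in> ell2 V"
  shows "ell2_proj V (ker_adj V S) f = f - S (L f)" and "f - S (L f) \<in> ker_adj V S"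
proof -
  have mem: "f - S (L f) \<in> ell2 V"
    using f by (simp add: ell2_diff_norm L_ell2 S_ell2)
  have "D (f - S (L f)) = 0"
    using f by (auto simp: D_diff S_ell2 L_ell2 D_S D_outside fun_eq_iff simp flip: D_eq_L)
  with mem show ker: "f - S (L f) \<in> ker_adj V S"
    by (simp add: ker_adj_S)
  show "ell2_proj V (ker_adj V S) f = f - S (L f)"
    unfolding ell2_proj_def
  proof (rule the_equality)
    show "f - S (L f) \<in> ker_adj V S \<and>
        (\<forall>h\<in>ker_adj V S. ell2_inner V (f - (f - S (L f))) h = 0)"
      using ker ker_orthogonal_S[OF L_ell2[OF f]] by simp
  next
    fix g assume g: "g \<in> ker_adj V S \<and> (\<forall>h\<in>ker_adj V S. ell2_inner V (f - g) h = 0)"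
    then have g2: "g \<in> ell2 V" "D g = 0"
      by (auto simp: ker_adj_S)
    \<comment> \<open>Both f - g and S (L f) are orthogonal to the kernel, and ?d is their
      difference. Lying in the kernel, it is orthogonal to itself.\<close>
    let ?d = "f - S (L f) - g"
    have d: "?d \<in> ell2 V"
      by (intro ell2_diff_norm mem g2)
    have dk: "?d \<in> ker_adj V S"
      using d g2 ker D_diff[OF mem g2(1)] by (simp add: ker_adj_S)
    have "ell2_inner V (f - g) ?d = 0"
      using g dk by blast
    moreover have "ell2_inner V (S (L f)) ?d = 0"
      by (rule ker_orthogonal_S[OF L_ell2[OF f] dk])
    moreover have "ell2_inner V (f - g - S (L f)) ?d =
        ell2_inner V (f - g) ?d - ell2_inner V (S (L f)) ?d"
      by (intro ell2_inner_diff_left ell2_diff_norm S_ell2 L_ell2 f g2(1) d)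
    moreover have "f - g - S (L f) = ?d"
      by (rule ext) simp
    ultimately have "ell2_inner V ?d ?d = 0"
      by simp
    then have "?d = 0"
      using ell2_inner_self_eq_0[OF d] by blast
    then show "g = f - S (L f)"
      by simp
  qed
qed

lemma model_coeff_S:
  assumes "f \<in> ell2 V"
  shows "model_coeff V S f n = (L ^^ n) f - S ((L ^^ Suc n) f)"
  unfolding model_coeff_def left_inv_S_pow[OF assms]
  using proj_ker(1)[OF L_pow_ell2[OF assms]] by simp

lemma model_coeff_ker:
  assumes "f \<in> ell2 V"
  shows "model_coeff V S f n \<in> ker_adj V S"
  unfolding model_coeff_S[OF assms] using proj_ker(2)[OF L_pow_ell2[OF assms]] by simp

section \<open>The Wold-type decomposition\<close>

lemma lev_subset: "lev k \<subseteq> V"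
  by (auto simp: level_def)

lemma ell2_lev_iff: "f \<in> ell2 (lev k) \<longleftrightarrow> f \<in> ell2 V \<and> (\<forall>v. dp v \<noteq> k \<longrightarrow> f v = 0)"
  unfolding ell2_subset_iff[OF lev_subset] using ell2_vanishes[of f V] by (auto simp: level_def)

text \<open>This is the weight of the theorem, by \<open>beta_root\<close>. The product form makes
  \<beta> (n + k) and \<beta> n directly comparable.\<close>

definition \<beta> :: "nat \<Rightarrow> real"
  where "\<beta> n = (\<Prod>i<n. q i)"

lemma beta_pos: "0 < \<beta> n"
  by (simp add: \<beta>_def prod_pos q_pos)

lemma beta_0: "\<beta> 0 = 1" and beta_Suc: "\<beta> (Suc n) = q n * \<beta> n"
  by (simp_all add: \<beta>_def mult.commute)

text \<open>This and \<open>beta_upper\<close> absorb the level k of a basis vector b: its iterate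
  S^n b has weight proportional to \<beta> (n + k), while the target space has weight \<beta>
  n.\<close>

lemma beta_lower: "0 \<le> \<delta> \<Longrightarrow> (\<And>k. \<delta> \<le> q k) \<Longrightarrow> \<delta> ^ k * \<beta> n \<le> \<beta> (n + k)"
  by (induction k) (auto simp: beta_Suc mult.assoc
      intro!: mult_mono mult_nonneg_nonneg less_imp_le[OF beta_pos] less_imp_le[OF q_pos])

lemma beta_upper: "0 \<le> C \<Longrightarrow> (\<And>k. q k \<le> C) \<Longrightarrow> \<beta> (n + k) \<le> C ^ k * \<beta> n"
  by (induction k) (auto simp: beta_Suc mult.assoc
      intro!: mult_mono mult_nonneg_nonneg less_imp_le[OF beta_pos] less_imp_le[OF q_pos])

lemma S_lev:
  assumes f: "f \<in> ell2 (lev k)"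
  shows "S f \<in> ell2 (lev (Suc k))" and "(ell2_norm V (S f))\<^sup>2 = q k * (ell2_norm V f)\<^sup>2"
proof -
  have fV: "f \<in> ell2 V" and f0: "\<And>v. dp v \<noteq> k \<Longrightarrow> f v = 0"
    using f by (auto simp: ell2_lev_iff)
  have "S f v = 0" if "dp v \<noteq> Suc k" for v
    using f0[of "par E v"] that depth_par[of v] by (auto simp: weighted_shift_def)
  then show "S f \<in> ell2 (lev (Suc k))"
    using S_ell2[OF fV] by (simp add: ell2_lev_iff)
  have "D (S f) = complex_of_real (q k) *\<^sub>C f"
  proof
    fix u
    show "D (S f) u = (complex_of_real (q k) *\<^sub>C f) u"
      using f0[of u] ell2_vanishes[OF fV, of u] by (cases "dp u = k") (auto simp: D_S cscale_def)
  qed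
  then have "ell2_inner V (S f) (S f) = complex_of_real (q k * (ell2_norm V f)\<^sup>2)"
    using S_adjoint[OF fV S_ell2[OF fV]] by (simp add: ell2_inner_cscale_right ell2_inner_self[OF fV])
  then show "(ell2_norm V (S f))\<^sup>2 = q k * (ell2_norm V f)\<^sup>2"
    unfolding ell2_inner_self[OF S_ell2[OF fV]] of_real_eq_iff .
qed

lemma S_pow_lev:
  assumes f: "f \<in> ell2 (lev k)"
  shows "(S ^^ n) f \<in> ell2 (lev (n + k)) \<and>
    \<beta> k * (ell2_norm V ((S ^^ n) f))\<^sup>2 = \<beta> (n + k) * (ell2_norm V f)\<^sup>2"
proof (induction n)
  case (Suc n)
  then show ?case
    using S_lev[of "(S ^^ n) f" "n + k"] by (simp add: beta_Suc mult.left_commute mult.assoc)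
qed (simp add: f)

lemma unit_root_lev: "unit_vec rt \<in> ell2 (lev 0)"
  using unit_vec_ell2[OF root_in] depth_root by (auto simp: ell2_lev_iff unit_vec_def)

lemma beta_root: "(ell2_norm V ((S ^^ n) (unit_vec rt)))\<^sup>2 = \<beta> n"
  using S_pow_lev[OF unit_root_lev, of n] by (simp add: beta_0 ell2_norm_unit_vec[OF root_in])

text \<open>Level k + 1 is exactly the set of vertices with parent on level k, and \<open>q\<close>
  is constant on a level, so the general estimate applies with the sharp constant.\<close>

lemma L_lev:
  assumes "f \<in> ell2 V"
  shows "(ell2_norm (lev k) (L f))\<^sup>2 \<le> (ell2_norm (lev (Suc k)) f)\<^sup>2 / q k"
proof -
  have "v \<noteq> rt" if "dp v = Suc m" for v m
    using that depth_root by auto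
  then have "{v \<in> V - {rt}. par E v \<in> lev k} = lev (Suc k)"
    using depth_par par_in unfolding level_def by fastforce
  moreover have "q k \<le> q (dp u)" if "u \<in> lev k" for u
    using that by (simp add: level_def)
  ultimately show ?thesis
    using L_norm_on(2)[OF assms lev_subset q_pos, of k k] by simp
qed

text \<open>Each application of \<open>L\<close> pulls a level down by one at the cost 1 / q of the
  lower level; these costs multiply to \<beta> k / \<beta> (n + k). The outermost \<open>L\<close>
  acts between levels k + 1 and k, so the induction has to vary k.\<close>

lemma L_pow_lev:
  assumes f: "f \<in> ell2 V"
  shows "\<beta> (n + k) * (ell2_norm (lev k) ((L ^^ n) f))\<^sup>2 \<le> \<beta> k * (ell2_norm (lev (n + k)) f)\<^sup>2"
proof (induction n arbitrary: k)
  case (Suc n)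
  have "\<beta> (Suc n + k) * (ell2_norm (lev k) ((L ^^ Suc n) f))\<^sup>2
      \<le> \<beta> (Suc n + k) * ((ell2_norm (lev (Suc k)) ((L ^^ n) f))\<^sup>2 / q k)"
    using L_lev[OF L_pow_ell2[OF f, of n], of k]
    by (intro mult_left_mono less_imp_le[OF beta_pos]) simp
  also have "\<dots> = \<beta> (n + Suc k) * (ell2_norm (lev (Suc k)) ((L ^^ n) f))\<^sup>2 / q k"
    by simp
  also have "\<dots> \<le> \<beta> (Suc k) * (ell2_norm (lev (n + Suc k)) f)\<^sup>2 / q k"
    by (intro divide_right_mono Suc.IH less_imp_le[OF q_pos])
  also have "\<dots> = \<beta> k * (ell2_norm (lev (Suc n + k)) f)\<^sup>2"
    using q_pos[of k] by (simp add: beta_Suc)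
  finally show ?case .
qed simp

lemma summable_lev_norm:
  assumes f: "f \<in> ell2 V"
  shows "summable (\<lambda>n. (ell2_norm (lev n) f)\<^sup>2)"
proof (rule summable_on_imp_summable)
  have "(\<lambda>v. (cmod (f v))\<^sup>2) summable_on V"
    using f by (simp add: ell2_def)
  from infsum_fibers(2)[OF subset_UNIV this, of dp]
  show "(\<lambda>n. (ell2_norm (lev n) f)\<^sup>2) summable_on UNIV"
    by (simp add: ell2_norm_power2 level_def)
qed

lemma inner_lev_bound:
  assumes f: "f \<in> ell2 V" and b: "b \<in> ell2 (lev k)"
  shows "cmod (ell2_inner V f b) \<le> ell2_norm (lev k) f * ell2_norm V b"
proof -
  have bV: "b \<in> ell2 V" and b0: "\<And>v. dp v \<noteq> k \<Longrightarrow> b v = 0"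
    using b by (auto simp: ell2_lev_iff)
  have "ell2_inner V f b = (\<Sum>\<^sub>\<infinity>v\<in>lev k. f v * cnj (b v))"
    unfolding ell2_inner_def
    by (rule infsum_cong_neutral) (use b0 lev_subset in \<open>auto simp: level_def\<close>)
  also have "cmod \<dots> \<le> ell2_norm (lev k) f * ell2_norm (lev k) (\<lambda>v. cnj (b v))"
    by (rule cauchy_schwarz_summable(2))
      (use ell2_summable[OF f lev_subset] ell2_summable[OF bV lev_subset] in auto)
  also have "ell2_norm (lev k) (\<lambda>v. cnj (b v)) = ell2_norm (lev k) b"
    by (simp add: ell2_norm_def)
  also have "ell2_norm (lev k) f * \<dots> \<le> ell2_norm (lev k) f * ell2_norm V b"
    by (intro mult_left_mono ell2_norm_subset[OF bV lev_subset]) simp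
  finally show ?thesis .
qed

text \<open>The projection only subtracts a vector in the range of \<open>S\<close>, which is
  orthogonal to b.\<close>

lemma inner_model_coeff:
  assumes "f \<in> ell2 V" "b \<in> ker_adj V S"
  shows "ell2_inner V (model_coeff V S f n) b = ell2_inner V ((L ^^ n) f) b"
proof -
  have "b \<in> ell2 V"
    using assms(2) by (simp add: ker_adj_S)
  then show ?thesis
    unfolding model_coeff_S[OF assms(1)]
    using ell2_inner_diff_left[of "(L ^^ n) f" V "S ((L ^^ Suc n) f)" b]
      L_pow_ell2[OF assms(1)] S_ell2[OF L_pow_ell2[OF assms(1)]]
      ker_orthogonal_S[OF L_pow_ell2[OF assms(1)] assms(2)]
    by (metis diff_zero)
qed

text \<open>Testing against b sees only level k of L^n f, which is controlled by level n + k of f.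
  The squared norms of f over the levels are summable.\<close>

lemma model_coeff_weighted_ell2:
  assumes f: "f \<in> ell2 V" and b: "b \<in> ell2 (lev k)" and bk: "b \<in> ker_adj V S"
  shows "(\<lambda>n. ell2_inner V (model_coeff V S f n) b) \<in> weighted_ell2 \<beta>"
proof -
  obtain \<delta> where d: "0 < \<delta>" "\<And>k. \<delta> \<le> q k"
    using q_bounds by metis
  let ?N = "\<lambda>n. (ell2_norm (lev n) f)\<^sup>2"
  \<comment> \<open>\<beta> k comes from \<open>L_pow_lev\<close>, and \<delta>^k pays for replacing
    \<beta> (n + k) by \<beta> n.\<close>
  let ?c = "\<beta> k / \<delta> ^ k * (ell2_norm V b)\<^sup>2"
  have "summable (\<lambda>n. ?c * ?N (n + k))"
    by (intro summable_mult summable_ignore_initial_segment summable_lev_norm f)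
  moreover have "norm ((cmod (ell2_inner V (model_coeff V S f n) b))\<^sup>2 * \<beta> n) \<le> ?c * ?N (n + k)" for n
  proof -
    let ?x = "(ell2_norm (lev k) ((L ^^ n) f))\<^sup>2"
    have "(cmod (ell2_inner V (model_coeff V S f n) b))\<^sup>2 \<le> ?x * (ell2_norm V b)\<^sup>2"
      using power_mono[OF inner_lev_bound[OF L_pow_ell2[OF f, of n] b] norm_ge_zero, of 2]
      by (simp add: inner_model_coeff[OF f bk] power_mult_distrib)
    then have "(cmod (ell2_inner V (model_coeff V S f n) b))\<^sup>2 * \<beta> n
        \<le> ?x * (ell2_norm V b)\<^sup>2 * \<beta> n"
      by (rule mult_right_mono) (rule less_imp_le[OF beta_pos])
    also have "\<dots> = (\<beta> n * ?x) * (ell2_norm V b)\<^sup>2"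
      by simp
    also have "\<dots> \<le> (\<beta> k / \<delta> ^ k * ?N (n + k)) * (ell2_norm V b)\<^sup>2"
    proof (rule mult_right_mono)
      have "\<delta> ^ k * \<beta> n * ?x \<le> \<beta> (n + k) * ?x"
        using beta_lower[of \<delta> k n] d by (intro mult_right_mono) auto
      also have "\<dots> \<le> \<beta> k * ?N (n + k)"
        by (rule L_pow_lev[OF f])
      finally show "\<beta> n * ?x \<le> \<beta> k / \<delta> ^ k * ?N (n + k)"
        using d by (simp add: field_simps)
    qed simp
    finally show ?thesis
      using beta_pos[of n] by (simp add: abs_mult mult_ac)
  qed
  ultimately have "summable (\<lambda>n. (cmod (ell2_inner V (model_coeff V S f n) b))\<^sup>2 * \<beta> n)"
    by (rule summable_comparison_test'[where N = 0])
  then show ?thesis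
    by (simp add: weighted_ell2_def)
qed

text \<open>For \<open>b\<close> supported on level \<open>k\<close>, \<open>lift h b k\<close> is \<open>\<Sum>\<^sub>n h n S\<^sup>n b\<close>; it is a pointwise formula because
  \<open>S\<^sup>n b\<close> lives on level \<open>n + k\<close>.\<close>

definition lift :: "(nat \<Rightarrow> complex) \<Rightarrow> ('v \<Rightarrow> complex) \<Rightarrow> nat \<Rightarrow> 'v \<Rightarrow> complex"
  where "lift h b k v = h (dp v - k) * (S ^^ (dp v - k)) b v"

text \<open>Truncated subtraction yields h 0 * b v here, which is 0 because b lives on level
  k.\<close>

lemma lift_below: "b \<in> ell2 (lev k) \<Longrightarrow> dp v < k \<Longrightarrow> lift h b k v = 0"
  by (simp add: lift_def ell2_lev_iff)

lemma lift_above: "dp v = n + k \<Longrightarrow> lift h b k v = h n * (S ^^ n) b v"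
  by (simp add: lift_def)

text \<open>The squared norm is computed level by level. Level n + k carries only h n times S^n b,
  whose norm is known from \<open>S_pow_lev\<close>, and the levels below k carry nothing.\<close>

lemma lift_ell2:
  assumes h: "h \<in> weighted_ell2 \<beta>" and b: "b \<in> ell2 (lev k)"
  shows "lift h b k \<in> ell2 V"
proof -
  have bV: "b \<in> ell2 V"
    using b by (simp add: ell2_lev_iff)
  let ?F = "\<lambda>v. (cmod (lift h b k v))\<^sup>2"
  have fib: "{v \<in> V. dp v = m} = lev m" for m
    by (simp add: level_def)
  have eq: "?F v = (cmod (h n))\<^sup>2 * (cmod ((S ^^ n) b v))\<^sup>2" if "v \<in> lev (n + k)" for v n
    using that lift_above[of v n k h b] by (simp add: level_def norm_mult power_mult_distrib)
  have eq0: "?F v = 0" if "v \<in> lev m" "m < k" for v m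
    using that lift_below[OF b] by (simp add: level_def)
  have s1: "?F summable_on lev m" for m
  proof (cases "m < k")
    case True
    then show ?thesis
      using eq0 by (simp cong: summable_on_cong)
  next
    case False
    then obtain n where m: "m = n + k"
      using le_Suc_ex[of k m] by (auto simp: add.commute)
    have "(\<lambda>v. (cmod (h n))\<^sup>2 * (cmod ((S ^^ n) b v))\<^sup>2) summable_on lev m"
      by (intro summable_on_cmult_right ell2_summable[OF S_pow_ell2[OF bV] lev_subset])
    then show ?thesis
      unfolding m by (rule summable_on_cong[THEN iffD1, rotated]) (rule eq[symmetric])
  qed
  obtain C where C: "0 < C" "\<And>k. q k \<le> C"
    using q_bounds by metis
  \<comment> \<open>C^k pays for replacing \<beta> (n + k) by \<beta> n; 1 / \<beta> k comes from
    \<open>S_pow_lev\<close>.\<close>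
  let ?c = "C ^ k / \<beta> k * (ell2_norm V b)\<^sup>2"
  have "summable (\<lambda>n. ?c * ((cmod (h n))\<^sup>2 * \<beta> n))"
    using h by (intro summable_mult) (simp add: weighted_ell2_def)
  moreover have "norm (infsum ?F (lev (n + k))) \<le> ?c * ((cmod (h n))\<^sup>2 * \<beta> n)" for n
  proof -
    have "infsum ?F (lev (n + k)) = (cmod (h n))\<^sup>2 * (ell2_norm (lev (n + k)) ((S ^^ n) b))\<^sup>2"
      unfolding ell2_norm_power2 infsum_cmult_right'[symmetric] by (rule infsum_cong) (rule eq)
    also have "\<dots> \<le> (cmod (h n))\<^sup>2 * (ell2_norm V ((S ^^ n) b))\<^sup>2"
      by (intro mult_left_mono power_mono ell2_norm_subset[OF S_pow_ell2[OF bV] lev_subset]) auto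
    also have "(ell2_norm V ((S ^^ n) b))\<^sup>2 = \<beta> (n + k) / \<beta> k * (ell2_norm V b)\<^sup>2"
      using S_pow_lev[OF b, of n] beta_pos[of k] by (simp add: field_simps)
    also have "(cmod (h n))\<^sup>2 * \<dots> \<le> (cmod (h n))\<^sup>2 * (C ^ k * \<beta> n / \<beta> k * (ell2_norm V b)\<^sup>2)"
      using beta_upper[of C n k] C beta_pos[of k]
      by (intro mult_left_mono mult_right_mono divide_right_mono) auto
    finally show ?thesis
      by (simp add: infsum_nonneg mult_ac)
  qed
  ultimately have "summable (\<lambda>n. infsum ?F (lev (n + k)))"
    by (rule summable_comparison_test'[where N = 0])
  then have "summable (\<lambda>n. infsum ?F (lev n))"
    by (subst (asm) summable_iff_shift)
  then have "(\<lambda>n. infsum ?F (lev n)) summable_on UNIV"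
    by (subst summable_on_UNIV_nonneg_real_iff) (auto simp: infsum_nonneg)
  then have "?F summable_on V"
    using summable_on_fibersI[of dp V UNIV ?F] s1 by (simp add: fib)
  moreover have "lift h b k v = 0" if "v \<notin> V" for v
    using ell2_vanishes[OF S_pow_ell2[OF bV] that] by (simp add: lift_def)
  ultimately show ?thesis
    by (simp add: ell2_def)
qed

text \<open>\<open>L\<close> cancels one \<open>S\<close> in each term and kills the term n = 0
  because D b = 0, so it acts on h as the backward shift.\<close>

lemma lift_L:
  assumes b: "b \<in> ell2 (lev k)" and bk: "b \<in> ker_adj V S"
  shows "L (lift h b k) = lift (\<lambda>n. h (Suc n)) b k"
proof
  fix u
  have bV: "b \<in> ell2 V" and b0: "\<And>v. dp v \<noteq> k \<Longrightarrow> b v = 0" and Db: "D b = 0"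
    using b bk by (auto simp: ell2_lev_iff ker_adj_S)
  show "L (lift h b k) u = lift (\<lambda>n. h (Suc n)) b k u"
  proof (cases "u \<in> V")
    case False
    then show ?thesis
      using ell2_vanishes[OF S_pow_ell2[OF bV] False] by (simp add: L_def D_outside lift_def)
  next
    case True
    \<comment> \<open>All children of u have depth dp u + 1, so they share this coefficient
      index.\<close>
    let ?n = "Suc (dp u) - k"
    have "D (lift h b k) u = (\<Sum>\<^sub>\<infinity>v\<in>children u. h ?n * (complex_of_real (lam v) * (S ^^ ?n) b v))"
      unfolding D_def by (rule infsum_cong) (simp add: lift_def depth_child)
    also have "\<dots> = h ?n * D ((S ^^ ?n) b) u"
      unfolding D_def by (rule infsum_cmult_right')
    finally have *: "D (lift h b k) u = h ?n * D ((S ^^ ?n) b) u" .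
    show ?thesis
    proof (cases "k \<le> dp u")
      case ge: True
      then have n: "?n = Suc (dp u - k)"
        by simp
      have "D ((S ^^ ?n) b) u = complex_of_real (q (dp u)) * (S ^^ (dp u - k)) b u"
        unfolding n using D_S[of "(S ^^ (dp u - k)) b" u] True by simp
      then show ?thesis
        using * q_pos[of "dp u"] n by (simp add: L_def lift_def)
    next
      \<comment> \<open>The children of u lie on level k or above it in the tree, so the truncated
        index is 0 and D b = 0 settles the case.\<close>
      case False
      then have "?n = 0"
        by simp
      then show ?thesis
        using * False b0[of u] Db lift_below[OF b, of u] by (simp add: L_def)
    qed
  qed
qed

text \<open>The term n = 0 is separated from the series, and one \<open>S\<close> is factored out of
  the rest.\<close>

lemma lift_split:
  assumes b: "b \<in> ell2 (lev k)"
  shows "S (lift (\<lambda>n. h (Suc n)) b k) + h 0 *\<^sub>C b = lift h b k"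
proof
  fix v
  have bV: "b \<in> ell2 V" and b0: "\<And>v. dp v \<noteq> k \<Longrightarrow> b v = 0"
    using b by (auto simp: ell2_lev_iff)
  let ?g = "lift (\<lambda>n. h (Suc n)) b k"
  have Sg: "S ?g v = (if v \<in> V - {rt} then complex_of_real (lam v) * ?g (par E v) else 0)"
    by (simp add: weighted_shift_def)
  show "(S ?g + h 0 *\<^sub>C b) v = lift h b k v"
  proof (cases "k < dp v")
    case True
    then obtain n where n: "dp v = Suc n + k"
      by (metis add.commute add_Suc_right less_iff_Suc_add)
    have lv: "lift h b k v = h (Suc n) * S ((S ^^ n) b) v"
      using lift_above[OF n, of h b] by simp
    show ?thesis
    proof (cases "v \<in> V - {rt}")
      case nr: True
      have "dp (par E v) = n + k"
        using depth_par[OF nr] n by simp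
      then show ?thesis
        using Sg nr lift_above[of "par E v" n k "\<lambda>n. h (Suc n)" b] lv b0[of v] True
        by (simp add: weighted_shift_def[of V E lam "(S ^^ n) b"] cscale_def)
    next
      case False
      then show ?thesis
        using Sg lv b0[of v] True by (auto simp: weighted_shift_def cscale_def)
    qed
  next
    case False
    have "?g (par E v) = 0" if "v \<in> V - {rt}"
      using depth_par[OF that] False by (intro lift_below[OF b]) simp
    then have "S ?g v = 0"
      using Sg by simp
    then show ?thesis
      using False b0[of v] by (cases "dp v = k") (auto simp: lift_def cscale_def)
  qed
qed

lemma lift_L_pow:
  assumes "b \<in> ell2 (lev k)" "b \<in> ker_adj V S"
  shows "(L ^^ n) (lift h b k) = lift (\<lambda>m. h (m + n)) b k"
proof (induction n)
  case (Suc n)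
  then show ?case
    using lift_L[OF assms, of "\<lambda>m. h (m + n)"] by simp
qed simp

text \<open>L^n shifts h by n; subtracting S L of the result leaves only its leading term, by
  \<open>lift_split\<close>. Hence every sequence in the weighted space is a coordinate of some
  Taylor sequence.\<close>

lemma model_coeff_lift:
  assumes h: "h \<in> weighted_ell2 \<beta>" and b: "b \<in> ell2 (lev k)" "b \<in> ker_adj V S"
  shows "model_coeff V S (lift h b k) n = h n *\<^sub>C b"
  unfolding model_coeff_S[OF lift_ell2[OF h b(1)]] lift_L_pow[OF b]
  using lift_split[OF b(1), of "\<lambda>m. h (m + n)"] by (simp add: algebra_simps)

section \<open>Spectrum and Taylor coefficients\<close>

lemma L_pow_norm:
  assumes "0 < A" "\<forall>f\<in>ell2 V. ell2_norm V (L f) \<le> A * ell2_norm V f" and f: "f \<in> ell2 V"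
  shows "ell2_norm V ((L ^^ n) f) \<le> A ^ n * ell2_norm V f"
proof (induction n)
  case (Suc n)
  have "ell2_norm V ((L ^^ Suc n) f) \<le> A * ell2_norm V ((L ^^ n) f)"
    using assms(2) L_pow_ell2[OF f] by simp
  also have "\<dots> \<le> A * (A ^ n * ell2_norm V f)"
    using Suc assms(1) by (intro mult_left_mono) auto
  finally show ?case
    by (simp add: mult.assoc)
qed simp

lemma L_pow_add:
  assumes "f \<in> ell2 V" "g \<in> ell2 V"
  shows "(L ^^ n) (f + g) = (L ^^ n) f + (L ^^ n) g"
proof (induction n)
  case (Suc n)
  show ?case
    unfolding funpow.simps comp_apply Suc by (rule L_add[OF L_pow_ell2 L_pow_ell2, OF assms])
qed simp

lemma L_tendsto:
  assumes s: "\<And>N. s N \<in> ell2 V" and g: "g \<in> ell2 V"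
    and lim: "(\<lambda>N. ell2_norm V (s N - g)) \<longlonglongrightarrow> 0"
  shows "(\<lambda>N. L (s N) u) \<longlonglongrightarrow> L g u"
proof -
  obtain A where A: "0 < A" "\<forall>f\<in>ell2 V. ell2_norm V (L f) \<le> A * ell2_norm V f"
    using L_bound by blast
  have lim0: "(\<lambda>N. A * ell2_norm V (s N - g)) \<longlonglongrightarrow> 0"
    using tendsto_mult_left[OF lim, of A] by simp
  have "norm (L (s N) u - L g u) \<le> A * ell2_norm V (s N - g)" for N
  proof -
    have d: "s N - g \<in> ell2 V"
      by (rule ell2_diff_norm(1)[OF s g])
    have "norm (L (s N) u - L g u) = cmod (L (s N - g) u)"
      by (simp add: L_diff[OF s g])
    also have "\<dots> \<le> ell2_norm V (L (s N - g))"
      by (rule cmod_le_ell2_norm[OF L_ell2[OF d]])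
    also have "\<dots> \<le> A * ell2_norm V (s N - g)"
      using A(2) d by blast
    finally show ?thesis .
  qed
  then have "(\<lambda>N. L (s N) u - L g u) \<longlonglongrightarrow> 0"
    by (intro Lim_null_comparison[OF always_eventually lim0] allI)
  then show ?thesis
    by (rule LIM_zero_cancel)
qed

text \<open>The Neumann series of the inverse of L - z. The minus sign reflects that
  \<open>spectrum\<close> subtracts z from the operator.\<close>

definition resolvent :: "complex \<Rightarrow> ('v \<Rightarrow> complex) \<Rightarrow> 'v \<Rightarrow> complex"
  where "resolvent z f v = (\<Sum>n. ((- (1 / z ^ Suc n)) *\<^sub>C (L ^^ n) f) v)"

context
  fixes A :: real and z :: complex
  assumes A: "0 < A" "\<forall>f\<in>ell2 V. ell2_norm V (L f) \<le> A * ell2_norm V f" and z: "A < cmod z"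
begin

lemma neumann_terms:
  assumes f: "f \<in> ell2 V"
  shows "(- (1 / z ^ Suc n)) *\<^sub>C (L ^^ n) f \<in> ell2 V"
    and "ell2_norm V ((- (1 / z ^ Suc n)) *\<^sub>C (L ^^ n) f)
      \<le> (ell2_norm V f / cmod z) * (A / cmod z) ^ n"
proof -
  show "(- (1 / z ^ Suc n)) *\<^sub>C (L ^^ n) f \<in> ell2 V"
    by (rule ell2_cscale[OF L_pow_ell2[OF f]])
  have "ell2_norm V ((- (1 / z ^ Suc n)) *\<^sub>C (L ^^ n) f) \<le> 1 / cmod z ^ Suc n * (A ^ n * ell2_norm V f)"
    unfolding ell2_norm_cscale
    using mult_left_mono[OF L_pow_norm[OF A f, of n], of "1 / cmod z ^ Suc n"]
    by (simp add: norm_divide norm_power norm_mult)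
  also have "\<dots> = (ell2_norm V f / cmod z) * (A / cmod z) ^ n"
    by (simp add: power_divide)
  finally show "ell2_norm V ((- (1 / z ^ Suc n)) *\<^sub>C (L ^^ n) f)
      \<le> (ell2_norm V f / cmod z) * (A / cmod z) ^ n" .
qed

lemma ratio: "0 \<le> A / cmod z" "A / cmod z < 1"
  using A(1) z by (auto simp: divide_less_eq)

lemmas neumann = ell2_geometric_series[OF neumann_terms ratio]

lemma resolvent_eq: "resolvent z f = (\<lambda>v. \<Sum>n. ((- (1 / z ^ Suc n)) *\<^sub>C (L ^^ n) f) v)"
  by (rule ext) (rule resolvent_def)

lemma resolvent_bounded: "bounded_operator V (ell2 V) (resolvent z)"
proof -
  have add: "resolvent z (f + g) = resolvent z f + resolvent z g" if fg: "f \<in> ell2 V" "g \<in> ell2 V" for f g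
  proof
    fix v
    have "((- (1 / z ^ Suc n)) *\<^sub>C (L ^^ n) (f + g)) v =
        ((- (1 / z ^ Suc n)) *\<^sub>C (L ^^ n) f) v + ((- (1 / z ^ Suc n)) *\<^sub>C (L ^^ n) g) v" for n
      unfolding L_pow_add[OF fg] by (simp add: cscale_def algebra_simps)
    then show "resolvent z (f + g) v = (resolvent z f + resolvent z g) v"
      unfolding resolvent_def plus_fun_apply
      using suminf_add[OF neumann(1)[OF fg(1) fg(1), of v] neumann(1)[OF fg(2) fg(2), of v]] by simp
  qed
  have scale: "resolvent z (c *\<^sub>C f) = c *\<^sub>C resolvent z f" if f: "f \<in> ell2 V" for c f
  proof
    fix v
    have "(L ^^ n) (c *\<^sub>C f) = c *\<^sub>C (L ^^ n) f" for n
      by (induction n) (auto simp: L_cscale)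
    then have "((- (1 / z ^ Suc n)) *\<^sub>C (L ^^ n) (c *\<^sub>C f)) v =
        c * ((- (1 / z ^ Suc n)) *\<^sub>C (L ^^ n) f) v" for n
      by (simp add: cscale_def)
    then show "resolvent z (c *\<^sub>C f) v = (c *\<^sub>C resolvent z f) v"
      using suminf_mult[OF neumann(1)[OF f f, of v], of c]
      by (simp add: resolvent_def cscale_def[of c "resolvent z f"])
  qed
  have "ell2_norm V (resolvent z f) \<le> (1 / cmod z / (1 - A / cmod z)) * ell2_norm V f"
    if "f \<in> ell2 V" for f
    unfolding resolvent_eq using neumann(3)[OF that that] by simp
  moreover have "resolvent z f \<in> ell2 V" if "f \<in> ell2 V" for f
    unfolding resolvent_eq by (rule neumann(2)[OF that that])
  ultimately show ?thesis
    unfolding bounded_operator_def using add scale by blast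
qed

text \<open>Inserting L f shifts the series by one index and multiplies it by z; the lost first term
  -f / z reappears as + f.\<close>

lemma resolvent_L:
  assumes f: "f \<in> ell2 V"
  shows "resolvent z (L f) = z *\<^sub>C resolvent z f + f"
proof
  fix v
  have z0: "z \<noteq> 0"
    using A(1) z by auto
  let ?a = "\<lambda>n. ((- (1 / z ^ Suc n)) *\<^sub>C (L ^^ n) f) v"
  note sm = neumann(1)[OF f f, of v]
  have "(\<Sum>n. ?a (Suc n)) = resolvent z f v - ?a 0"
    unfolding resolvent_def by (rule suminf_split_head[OF sm])
  moreover have "((- (1 / z ^ Suc n)) *\<^sub>C (L ^^ n) (L f)) v = z * ?a (Suc n)" for n
    using z0 by (simp add: cscale_def funpow_swap1)
  then have "resolvent z (L f) v = z * (\<Sum>n. ?a (Suc n))"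
    unfolding resolvent_def using suminf_mult[OF summable_Suc_iff[THEN iffD2, OF sm], of z]
    by (simp only:)
  ultimately show "resolvent z (L f) v = (z *\<^sub>C resolvent z f + f) v"
    using z0 by (simp add: cscale_def algebra_simps)
qed

text \<open>\<open>L\<close> commutes with the partial sums, and norm convergence is enough for
  \<open>L\<close> to pass to the pointwise limit.\<close>

lemma L_resolvent:
  assumes f: "f \<in> ell2 V"
  shows "L (resolvent z f) = resolvent z (L f)"
proof
  fix u
  let ?s = "\<lambda>g N. \<Sum>n<N. (- (1 / z ^ Suc n)) *\<^sub>C (L ^^ n) g"
  have s: "?s g N \<in> ell2 V" if "g \<in> ell2 V" for g N
    by (rule ell2_sum_norm[THEN conjunct1]) (rule neumann_terms(1)[OF that])
  have r: "resolvent z f \<in> ell2 V"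
    unfolding resolvent_eq by (rule neumann(2)[OF f f])
  have Ls: "L (?s f N) = ?s (L f) N" for N
  proof (induction N)
    case 0
    show ?case
      unfolding lessThan_0 sum.empty by (rule L_0)
  next
    case (Suc N)
    have "L (?s f N + (- (1 / z ^ Suc N)) *\<^sub>C (L ^^ N) f)
        = L (?s f N) + (- (1 / z ^ Suc N)) *\<^sub>C (L ^^ N) (L f)"
      unfolding L_add[OF s[OF f] neumann_terms(1)[OF f]] L_cscale
      by (simp add: funpow_swap1)
    then show ?case
      unfolding sum.lessThan_Suc Suc .
  qed
  have "(\<lambda>N. ell2_norm V f / cmod z * (A / cmod z) ^ N / (1 - A / cmod z)) \<longlonglongrightarrow>
      ell2_norm V f / cmod z * 0 / (1 - A / cmod z)"
    by (intro tendsto_intros LIMSEQ_power_zero) (use ratio in auto)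
  then have lim0: "(\<lambda>N. ell2_norm V f / cmod z * (A / cmod z) ^ N / (1 - A / cmod z)) \<longlonglongrightarrow> 0"
    by simp
  have "(\<lambda>N. ell2_norm V (?s f N - resolvent z f)) \<longlonglongrightarrow> 0"
    by (rule Lim_null_comparison[OF always_eventually lim0])
      (use neumann(4)[OF f f] in \<open>simp add: resolvent_eq\<close>)
  from L_tendsto[OF s[OF f] r this, of u]
  have "(\<lambda>N. ?s (L f) N u) \<longlonglongrightarrow> L (resolvent z f) u"
    unfolding Ls .
  moreover have "(\<lambda>N. ?s (L f) N u) \<longlonglongrightarrow> resolvent z (L f) u"
    unfolding resolvent_def sum_fun_apply
    by (rule summable_LIMSEQ[OF neumann(1)[OF L_ell2[OF f] L_ell2[OF f]]])
  ultimately show "L (resolvent z f) u = resolvent z (L f) u"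
    by (rule LIMSEQ_unique)
qed

text \<open>This bounds the spectrum by A, so that the supremum in \<open>spectral_radius\<close> is
  taken over a bounded set.\<close>

lemma outside_spectrum: "z \<notin> spectrum V (left_inv V S)"
proof -
  note R = resolvent_bounded[unfolded bounded_operator_def]
  have "resolvent z (left_inv V S f - z *\<^sub>C f) = f \<and>
      left_inv V S (resolvent z f) - z *\<^sub>C resolvent z f = f" if f: "f \<in> ell2 V" for f
  proof
    have "resolvent z (L f + (- z) *\<^sub>C f) = resolvent z (L f) + (- z) *\<^sub>C resolvent z f"
      using R f L_ell2[OF f] ell2_cscale[OF f] by metis
    moreover have "L f + (- z) *\<^sub>C f = L f - z *\<^sub>C f"
      by (simp add: cscale_def fun_eq_iff)
    moreover have "resolvent z (L f) + (- z) *\<^sub>C resolvent z f = f"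
      unfolding resolvent_L[OF f] by (simp add: cscale_def fun_eq_iff)
    ultimately show "resolvent z (left_inv V S f - z *\<^sub>C f) = f"
      by (simp add: left_inv_S[OF f])
    have "left_inv V S (resolvent z f) = z *\<^sub>C resolvent z f + f"
      using R f by (simp add: left_inv_S L_resolvent resolvent_L)
    then show "left_inv V S (resolvent z f) - z *\<^sub>C resolvent z f = f"
      by simp
  qed
  then show ?thesis
    unfolding spectrum_def using resolvent_bounded by blast
qed

end

section \<open>Positivity of the spectral radius\<close>

lemma unit_root_ker: "unit_vec rt \<in> ker_adj V S"
proof -
  have "D (unit_vec rt) u = 0" for u
    unfolding D_def by (rule infsum_0) (auto simp: unit_vec_def children_def)
  then show ?thesis
    using unit_vec_ell2[OF root_in] by (auto simp: ker_adj_S fun_eq_iff)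
qed

text \<open>This excludes a vanishing spectral radius, for which \<^const>\<open>model_map\<close> would be identically zero
  (\<open>1 / 0 = 0\<close>). The eigenvectors are \<open>\<Sum>\<^sub>n z\<^sup>n S\<^sup>n e\<close> with \<open>e = unit_vec rt\<close>.\<close>

lemma spectrum_nonzero: "\<exists>z\<in>spectrum V (left_inv V S). z \<noteq> 0"
proof -
  obtain C where C: "0 < C" "\<And>k. q k \<le> C"
    using q_bounds by metis
  \<comment> \<open>Since \<beta> n \<le> C^n, the choice |z|^2 = 1 / (2 C) dominates the weighted
    squares by (1 / 2)^n.\<close>
  define z where "z = complex_of_real (sqrt (1 / (2 * C)))"
  define h where "h = (\<lambda>n. z ^ n)"
  let ?g = "lift h (unit_vec rt) 0"
  have z0: "z \<noteq> 0"
    using C by (simp add: z_def)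
  have zz: "(cmod z)\<^sup>2 = 1 / (2 * C)"
    using C by (simp add: z_def)
  have "summable (\<lambda>n. (cmod (h n))\<^sup>2 * \<beta> n)"
  proof (rule summable_comparison_test'[where N = 0])
    show "summable (\<lambda>n. (1 / 2 :: real) ^ n)"
      by (rule summable_geometric) simp
    show "norm ((cmod (h n))\<^sup>2 * \<beta> n) \<le> (1 / 2) ^ n" for n
    proof -
      have "(cmod (h n))\<^sup>2 * \<beta> n = (1 / (2 * C)) ^ n * \<beta> n"
        by (simp add: h_def norm_power power_mult[symmetric] mult.commute[of n 2] flip: zz)
      also have "\<dots> \<le> (1 / (2 * C)) ^ n * C ^ n"
        using beta_upper[of C 0 n] C by (intro mult_left_mono) (auto simp: beta_0)
      also have "\<dots> = (1 / 2) ^ n"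
        using C by (simp add: power_mult_distrib[symmetric])
      finally show ?thesis
        using beta_pos[of n] by (simp add: abs_mult)
    qed
  qed
  then have g: "?g \<in> ell2 V"
    using unit_root_lev by (intro lift_ell2) (simp add: weighted_ell2_def)
  have "L ?g = z *\<^sub>C ?g"
    unfolding lift_L[OF unit_root_lev unit_root_ker]
    by (rule ext) (simp add: lift_def cscale_def h_def)
  then have Lg: "left_inv V S ?g - z *\<^sub>C ?g = 0"
    by (simp add: left_inv_S[OF g])
  have "?g rt = 1"
    by (simp add: lift_def depth_root h_def unit_vec_def)
  then have "?g \<noteq> 0"
    by auto
  have False if B: "bounded_operator V (ell2 V) B"
    "\<forall>f\<in>ell2 V. B (left_inv V S f - z *\<^sub>C f) = f \<and> left_inv V S (B f) - z *\<^sub>C B f = f" for B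
  proof -
    have "B 0 = ?g"
      using B(2) g Lg by metis
    moreover have "B (0 + 0) = B 0 + B 0"
      using B(1) ell2_zero unfolding bounded_operator_def by blast
    ultimately show False
      using \<open>?g \<noteq> 0\<close> by simp
  qed
  then have "z \<in> spectrum V (left_inv V S)"
    unfolding spectrum_def by blast
  then show ?thesis
    using z0 by blast
qed

lemma spectral_radius_pos: "0 < spectral_radius V (left_inv V S)"
proof -
  obtain A where A: "0 < A" "\<forall>f\<in>ell2 V. ell2_norm V (L f) \<le> A * ell2_norm V f"
    using L_bound by blast
  have bdd: "bdd_above (cmod ` spectrum V (left_inv V S))"
    using outside_spectrum[OF A] by (intro bdd_aboveI2[of _ _ A]) force
  obtain z where z: "z \<in> spectrum V (left_inv V S)" "z \<noteq> 0"
    using spectrum_nonzero by blast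
  then have "0 < cmod z"
    by simp
  also have "\<dots> \<le> spectral_radius V (left_inv V S)"
    unfolding spectral_radius_def by (rule cSUP_upper[OF z(1) bdd])
  finally show ?thesis .
qed

text \<open>The radius r may be smaller than that of the disc: geometric domination with ratio A |z|
  works only for |z| < 1 / A. Any neighbourhood of 0 suffices to determine the coefficients.\<close>

lemma model_map_series:
  "\<exists>r>0. \<forall>f\<in>ell2 V. \<forall>z v. cmod z < r \<longrightarrow>
    (\<lambda>n. model_coeff V S f n v * z ^ n) sums model_map V S f z v"
proof -
  obtain A where A: "0 < A" "\<forall>f\<in>ell2 V. ell2_norm V (L f) \<le> A * ell2_norm V f"
    using L_bound by blast
  obtain C where C: "0 < C" "\<forall>f\<in>ell2 V. ell2_norm V (S f) \<le> C * ell2_norm V f"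
    using S_bound by blast
  let ?R = "1 / spectral_radius V (left_inv V S)"
  \<comment> \<open>The second bound keeps z in the disc, away from the default value 0 of
    \<open>model_map\<close>.\<close>
  define r where "r = min (1 / A) ?R"
  have "0 < r"
    using A(1) spectral_radius_pos by (simp add: r_def)
  moreover have "(\<lambda>n. model_coeff V S f n v * z ^ n) sums model_map V S f z v"
    if f: "f \<in> ell2 V" and zr: "cmod z < r" for f z v
  proof -
    let ?a = "\<lambda>n. z ^ n *\<^sub>C model_coeff V S f n"
    \<comment> \<open>Writing the coefficient as L^n f - S (L^(n+1) f) gives the factor A^n + C
      A^(n+1) = (1 + C A) A^n.\<close>
    let ?M = "(1 + C * A) * ell2_norm V f"
    have a: "?a n \<in> ell2 V" for n
      using model_coeff_ker[OF f, of n] by (intro ell2_cscale) (simp add: ker_adj_S)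
    have M: "ell2_norm V (?a n) \<le> ?M * (cmod z * A) ^ n" for n
    proof -
      have "ell2_norm V (model_coeff V S f n)
          \<le> ell2_norm V ((L ^^ n) f) + ell2_norm V (S ((L ^^ Suc n) f))"
        unfolding model_coeff_S[OF f] by (intro ell2_diff_norm S_ell2 L_pow_ell2 f)
      also have "\<dots> \<le> A ^ n * ell2_norm V f + C * (A ^ Suc n * ell2_norm V f)"
      proof (rule add_mono)
        have "ell2_norm V (S ((L ^^ Suc n) f)) \<le> C * ell2_norm V ((L ^^ Suc n) f)"
          using C(2) L_pow_ell2[OF f, of "Suc n"] by blast
        also have "\<dots> \<le> C * (A ^ Suc n * ell2_norm V f)"
          using C(1) by (intro mult_left_mono L_pow_norm[OF A f]) simp
        finally show "ell2_norm V (S ((L ^^ Suc n) f)) \<le> C * (A ^ Suc n * ell2_norm V f)" .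
      qed (rule L_pow_norm[OF A f])
      also have "\<dots> = ?M * A ^ n"
        by (simp add: algebra_simps)
      finally have "cmod z ^ n * ell2_norm V (model_coeff V S f n) \<le> cmod z ^ n * (?M * A ^ n)"
        by (rule mult_left_mono) simp
      then show ?thesis
        by (simp add: ell2_norm_cscale norm_power power_mult_distrib mult_ac)
    qed
    have t: "0 \<le> cmod z * A" "cmod z * A < 1"
      using zr A(1) by (auto simp: r_def field_simps)
    have "model_map V S f z v = ell2_suminf V ?a v"
      using zr by (simp add: model_map_def r_def)
    also have "\<dots> = (\<Sum>n. ?a n v)"
      unfolding ell2_suminf_geometric[OF a M t] ..
    finally have "(\<lambda>n. ?a n v) sums model_map V S f z v"
      using summable_sums[OF ell2_geometric_series(1)[OF a M t, of v]] by simp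
    then show ?thesis
      by (simp add: cscale_def mult.commute)
  qed
  ultimately show ?thesis
    by blast
qed

text \<open>\<^const>\<open>taylor_coeff\<close> refers to some preimage; which one is irrelevant, since the power series already
  determines its coefficients.\<close>

lemma taylor_coeff_model_map:
  assumes f: "f \<in> ell2 V"
  shows "taylor_coeff V S (model_map V S f) n = model_coeff V S f n"
proof -
  define g where "g = inv_into (ell2 V) (model_map V S) (model_map V S f)"
  have g: "g \<in> ell2 V" "model_map V S g = model_map V S f"
    using f inv_into_into[of "model_map V S f" "model_map V S" "ell2 V"]
      f_inv_into_f[of "model_map V S f" "model_map V S" "ell2 V"] by (auto simp: g_def)
  obtain r where r: "0 < r" "\<forall>f\<in>ell2 V. \<forall>z v. cmod z < r \<longrightarrow>
    (\<lambda>n. model_coeff V S f n v * z ^ n) sums model_map V S f z v"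
    using model_map_series by blast
  have "model_coeff V S g n v - model_coeff V S f n v = 0" for v
  proof (rule powser_zero_coeff[OF r(1)])
    fix z :: complex
    assume "cmod z < r"
    then have "(\<lambda>n. model_coeff V S g n v * z ^ n) sums model_map V S f z v"
      "(\<lambda>n. model_coeff V S f n v * z ^ n) sums model_map V S f z v"
      using r(2) f g by metis+
    from sums_diff[OF this]
    show "(\<lambda>n. (model_coeff V S g n v - model_coeff V S f n v) * z ^ n) sums 0"
      by (simp add: algebra_simps)
  qed
  then show ?thesis
    by (simp add: taylor_coeff_def g_def[symmetric] fun_eq_iff)
qed

section \<open>Multipliers\<close>

lemma ker_subset: "ker_adj V S \<subseteq> ell2 V"
  by (auto simp: ker_adj_S)

lemma ker_subspace: "cfun.subspace (ker_adj V S)"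
proof -
  have "D 0 = 0"
    by (rule ext) (simp add: D_def)
  moreover have "f + g \<in> ker_adj V S" if "f \<in> ker_adj V S" "g \<in> ker_adj V S" for f g
    using that ell2_add_norm(1)[of f V g] D_add[of f g] by (simp add: ker_adj_S)
  moreover have "c *\<^sub>C f \<in> ker_adj V S" if "f \<in> ker_adj V S" for c f
  proof -
    have "c *\<^sub>C (0 :: 'v \<Rightarrow> complex) = 0"
      by (rule cfun.scale_zero_right)
    then show ?thesis
      using that ell2_cscale[of f V c] D_cscale[of c f] by (simp add: ker_adj_S)
  qed
  ultimately show ?thesis
    unfolding cfun.subspace_def by (simp add: ker_adj_S)
qed

lemma ker_sum: "(\<And>i. i \<in> I \<Longrightarrow> f i \<in> ker_adj V S) \<Longrightarrow> sum f I \<in> ker_adj V S"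
  by (rule cfun.subspace_sum[OF ker_subspace])

lemma ker_cscale: "f \<in> ker_adj V S \<Longrightarrow> c *\<^sub>C f \<in> ker_adj V S"
  by (rule cfun.subspace_scale[OF ker_subspace])

text \<open>B is known to be linear only on the kernel, so all partial sums must be kept inside
  it.\<close>

lemma bounded_operator_sum:
  assumes B: "bounded_operator V (ker_adj V S) B" and f: "\<And>i. i \<in> I \<Longrightarrow> f i \<in> ker_adj V S"
  shows "B (\<Sum>i\<in>I. c i *\<^sub>C f i) = (\<Sum>i\<in>I. c i *\<^sub>C B (f i))"
proof -
  have add: "B (g + h) = B g + B h" if "g \<in> ker_adj V S" "h \<in> ker_adj V S" for g h
    using B that unfolding bounded_operator_def by blast
  have scale: "B (a *\<^sub>C g) = a *\<^sub>C B g" if "g \<in> ker_adj V S" for a g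
    using B that unfolding bounded_operator_def by blast
  have B0: "B 0 = 0"
    using scale[OF cfun.subspace_0[OF ker_subspace], of 0] by (simp only: cfun.scale_zero_left)
  show ?thesis
    using f
  proof (induction I rule: infinite_finite_induct)
    case (insert i I)
    have "B (c i *\<^sub>C f i + (\<Sum>i\<in>I. c i *\<^sub>C f i)) = c i *\<^sub>C B (f i) + B (\<Sum>i\<in>I. c i *\<^sub>C f i)"
      using add[of "c i *\<^sub>C f i" "\<Sum>i\<in>I. c i *\<^sub>C f i"] scale[of "f i" "c i"] ker_cscale ker_sum[of I "\<lambda>i. c i *\<^sub>C f i"]
        insert.prems by auto
    moreover have "B (\<Sum>i\<in>I. c i *\<^sub>C f i) = (\<Sum>i\<in>I. c i *\<^sub>C B (f i))"
      using insert by blast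
    ultimately show ?case
      unfolding sum.insert[OF insert.hyps] by (simp only:)
  qed (simp_all only: sum.infinite sum.empty B0 not_False_eq_True)
qed

lemma model_coeff_0: "model_coeff V S 0 n = 0"
proof -
  have "(L ^^ n) 0 = 0" for n
    by (induction n) (simp_all only: funpow.simps id_apply comp_apply L_0)
  then show ?thesis
    unfolding model_coeff_S[OF ell2_zero] by (simp only: S_0 diff_0_right)
qed

lemma model_coeff_sum:
  assumes "\<And>i. i \<in> I \<Longrightarrow> f i \<in> ell2 V"
  shows "model_coeff V S (\<Sum>i\<in>I. f i) n = (\<Sum>i\<in>I. model_coeff V S (f i) n)"
  using assms
proof (induction I rule: infinite_finite_induct)
  case (insert i I)
  have fi: "f i \<in> ell2 V" and fI: "sum f I \<in> ell2 V"
    using insert.prems ell2_sum_norm[of I f V] by blast+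
  have "model_coeff V S (f i + sum f I) n = model_coeff V S (f i) n + model_coeff V S (sum f I) n"
    unfolding model_coeff_S[OF fi] model_coeff_S[OF fI] model_coeff_S[OF ell2_add_norm(1)[OF fi fI]]
      L_pow_add[OF fi fI] S_add
    by (rule ext) simp
  moreover have "model_coeff V S (sum f I) n = (\<Sum>i\<in>I. model_coeff V S (f i) n)"
    using insert by blast
  ultimately show ?case
    unfolding sum.insert[OF insert.hyps] by (simp only:)
qed (simp_all only: sum.infinite sum.empty model_coeff_0 not_False_eq_True)

text \<open>Functions on the disc are traded for their preimages in \<open>ell2 V\<close>; from here
  on only coefficient sequences matter.\<close>

lemma multiplier_domain_eq_iff:
  "multiplier_domain V S \<phi> = model_space V S \<longleftrightarrow>
    (\<forall>f\<in>ell2 V. \<exists>g\<in>ell2 V. \<forall>n. model_coeff V S g n = (\<Sum>k\<le>n. \<phi> k (model_coeff V S f (n - k))))"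
proof -
  have *: "{F \<in> X. P F} = X \<longleftrightarrow> (\<forall>F\<in>X. P F)" for X :: "'a set" and P
    by blast
  show ?thesis
    unfolding multiplier_domain_def model_space_def * by (simp add: taylor_coeff_model_map)
qed

theorem generalized_multipliers_eq:
  assumes fd: "finite_dimensional (ker_adj V S)" and sb: "separated_basis V E lam J b"
  shows "generalized_multipliers V S =
    {\<phi>. (\<forall>n. \<phi> n \<in> bounded_operators V (ker_adj V S)) \<and>
         (\<forall>i\<in>J. \<forall>j\<in>J. (\<lambda>n. ell2_inner V (\<phi> n (b j)) (b i)) \<in> H_inf \<beta>)}"
proof -
  have ob: "orthonormal_basis V (ker_adj V S) J b"
    using sb by (simp add: separated_basis_def)
  obtain d where d: "\<And>j. j \<in> J \<Longrightarrow> b j \<in> ell2 (lev (d j))"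
    using sb unfolding separated_basis_def by metis
  have bK: "b j \<in> ker_adj V S" if "j \<in> J" for j
    using ob that by (simp add: orthonormal_basis_def)
  have bV: "b j \<in> ell2 V" if "j \<in> J" for j
    using bK[OF that] ker_subset by blast
  have J: "finite J"
    by (rule orthonormal_basis_finite[OF ker_subset ob fd])
  note expand = orthonormal_basis_expansion[OF ker_subset ob J]
  have "multiplier_domain V S \<phi> = model_space V S \<longleftrightarrow>
      (\<forall>i\<in>J. \<forall>j\<in>J. (\<lambda>n. ell2_inner V (\<phi> n (b j)) (b i)) \<in> H_inf \<beta>)"
    if \<phi>: "\<forall>n. \<phi> n \<in> bounded_operators V (ker_adj V S)" for \<phi>
  proof -
    have op: "bounded_operator V (ker_adj V S) (\<phi> n)" for n
      using \<phi> by (auto simp: bounded_operators_def)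
    have \<phi>K: "\<phi> n f \<in> ker_adj V S" if "f \<in> ker_adj V S" for n f
      using op[of n] that unfolding bounded_operator_def by blast
    have \<phi>scale: "\<phi> n (c *\<^sub>C f) = c *\<^sub>C \<phi> n f" if "f \<in> ker_adj V S" for n c f
      using op[of n] that unfolding bounded_operator_def by blast
    show ?thesis
      unfolding multiplier_domain_eq_iff
    proof (intro iffI ballI)
      fix i j
      assume *: "\<forall>f\<in>ell2 V. \<exists>g\<in>ell2 V. \<forall>n.
          model_coeff V S g n = (\<Sum>k\<le>n. \<phi> k (model_coeff V S f (n - k)))"
        and i: "i \<in> J" and j: "j \<in> J"
      show "(\<lambda>n. ell2_inner V (\<phi> n (b j)) (b i)) \<in> H_inf \<beta>"
        unfolding H_inf_def
      proof (intro CollectI ballI)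
        fix a assume a: "a \<in> weighted_ell2 \<beta>"
        \<comment> \<open>The test vector has coefficients a n times b j, so the i-th coordinate of
          the product sequence is the convolution of one matrix entry with a.\<close>
        obtain g where g: "g \<in> ell2 V" "\<And>n. model_coeff V S g n =
            (\<Sum>k\<le>n. \<phi> k (model_coeff V S (lift a (b j) (d j)) (n - k)))"
          using * lift_ell2[OF a d[OF j]] by blast
        have "ell2_inner V (model_coeff V S g n) (b i) = conv (\<lambda>n. ell2_inner V (\<phi> n (b j)) (b i)) a n" for n
        proof -
          have "ell2_inner V (model_coeff V S g n) (b i) =
              ell2_inner V (\<Sum>k\<le>n. a (n - k) *\<^sub>C \<phi> k (b j)) (b i)"
            unfolding g(2) model_coeff_lift[OF a d[OF j] bK[OF j]] \<phi>scale[OF bK[OF j]] ..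
          also have "\<dots> = (\<Sum>k\<le>n. ell2_inner V (a (n - k) *\<^sub>C \<phi> k (b j)) (b i))"
            by (rule ell2_inner_sum_left[OF ell2_cscale bV[OF i]])
              (use \<phi>K[OF bK[OF j]] ker_subset in blast)
          finally show ?thesis
            by (simp add: conv_def ell2_inner_cscale_left mult.commute)
        qed
        then show "conv (\<lambda>n. ell2_inner V (\<phi> n (b j)) (b i)) a \<in> weighted_ell2 \<beta>"
          using model_coeff_weighted_ell2[OF g(1) d[OF i] bK[OF i]] by simp
      qed
    next
      fix f
      assume H: "\<forall>i\<in>J. \<forall>j\<in>J. (\<lambda>n. ell2_inner V (\<phi> n (b j)) (b i)) \<in> H_inf \<beta>"
        and f: "f \<in> ell2 V"
      \<comment> \<open>?G is the sequence a solution must have as Taylor coefficients, and ?h i is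
        its i-th coordinate.\<close>
      let ?F = "\<lambda>n. model_coeff V S f n"
      let ?G = "\<lambda>n. \<Sum>k\<le>n. \<phi> k (?F (n - k))"
      let ?h = "\<lambda>i n. ell2_inner V (?G n) (b i)"
      have GK: "?G n \<in> ker_adj V S" for n
        by (rule ker_sum) (rule \<phi>K[OF model_coeff_ker[OF f]])
      have h: "?h i \<in> weighted_ell2 \<beta>" if i: "i \<in> J" for i
      proof -
        have "?h i n = (\<Sum>j\<in>J. conv (\<lambda>n. ell2_inner V (\<phi> n (b j)) (b i)) (\<lambda>n. ell2_inner V (?F n) (b j)) n)" for n
        proof -
          \<comment> \<open>Matrix multiplication in the basis b: the vector is expanded before
            \<phi> k is applied.\<close>
          have summand: "ell2_inner V (\<phi> k (?F m)) (b i) =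
              (\<Sum>j\<in>J. ell2_inner V (\<phi> k (b j)) (b i) * ell2_inner V (?F m) (b j))" for k m
          proof -
            have "\<phi> k (?F m) = \<phi> k (\<Sum>j\<in>J. ell2_inner V (?F m) (b j) *\<^sub>C b j)"
              using expand[OF model_coeff_ker[OF f, of m]] by (rule arg_cong)
            also have "\<dots> = (\<Sum>j\<in>J. ell2_inner V (?F m) (b j) *\<^sub>C \<phi> k (b j))"
              by (rule bounded_operator_sum[OF op bK])
            finally have "ell2_inner V (\<phi> k (?F m)) (b i) =
                ell2_inner V (\<Sum>j\<in>J. ell2_inner V (?F m) (b j) *\<^sub>C \<phi> k (b j)) (b i)"
              by (rule arg_cong)
            also have "\<dots> = (\<Sum>j\<in>J. ell2_inner V (ell2_inner V (?F m) (b j) *\<^sub>C \<phi> k (b j)) (b i))"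
              by (rule ell2_inner_sum_left[OF ell2_cscale bV[OF i]]) (use \<phi>K bK ker_subset in blast)
            finally show ?thesis
              by (simp add: ell2_inner_cscale_left mult.commute)
          qed
          have "?h i n = (\<Sum>k\<le>n. ell2_inner V (\<phi> k (?F (n - k))) (b i))"
            by (rule ell2_inner_sum_left[OF _ bV[OF i]])
              (use \<phi>K[OF model_coeff_ker[OF f]] ker_subset in blast)
          also have "\<dots> = (\<Sum>j\<in>J. \<Sum>k\<le>n. ell2_inner V (\<phi> k (b j)) (b i) * ell2_inner V (?F (n - k)) (b j))"
            unfolding summand by (rule sum.swap)
          finally show ?thesis
            by (simp only: conv_def)
        qed
        moreover have "(\<lambda>n. \<Sum>j\<in>J. conv (\<lambda>n. ell2_inner V (\<phi> n (b j)) (b i)) (\<lambda>n. ell2_inner V (?F n) (b j)) n) \<in> weighted_ell2 \<beta>"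
        proof (rule weighted_ell2_sum)
          fix j assume j: "j \<in> J"
          show "conv (\<lambda>n. ell2_inner V (\<phi> n (b j)) (b i)) (\<lambda>n. ell2_inner V (?F n) (b j)) \<in> weighted_ell2 \<beta>"
            using H i j model_coeff_weighted_ell2[OF f d[OF j] bK[OF j]] unfolding H_inf_def by blast
        qed (rule less_imp_le[OF beta_pos])
        ultimately show ?thesis
          by (simp only:)
      qed
      \<comment> \<open>Each coordinate sequence is realized by its own lift, from the level d i of
        its basis vector; the coefficients add up to the basis expansion of ?G n.\<close>
      let ?g = "\<Sum>i\<in>J. lift (?h i) (b i) (d i)"
      have lV: "lift (?h i) (b i) (d i) \<in> ell2 V" if "i \<in> J" for i
        by (rule lift_ell2[OF h[OF that] d[OF that]])
      have "model_coeff V S ?g n = ?G n" for n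
      proof -
        have "model_coeff V S ?g n = (\<Sum>i\<in>J. model_coeff V S (lift (?h i) (b i) (d i)) n)"
          by (rule model_coeff_sum[OF lV])
        also have "\<dots> = (\<Sum>i\<in>J. ?h i n *\<^sub>C b i)"
          by (rule sum.cong[OF refl]) (rule model_coeff_lift[OF h d bK])
        also have "\<dots> = ?G n"
          by (rule expand[OF GK, symmetric])
        finally show ?thesis .
      qed
      moreover have "?g \<in> ell2 V"
        by (rule ell2_sum_norm[THEN conjunct1]) (rule lV)
      ultimately show "\<exists>g\<in>ell2 V. \<forall>n. model_coeff V S g n = ?G n"
        by blast
    qed
  qed
  then show ?thesis
    unfolding generalized_multipliers_def by blast
qed

end

theorem theorem24:
  fixes V :: "'v set" and E :: "('v \<times> 'v) set" and lam :: "'v \<Rightarrow> real"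
    and J :: "'j set" and b :: "'j \<Rightarrow> 'v \<Rightarrow> complex"
  assumes "rooted_directed_tree V E" and "leafless V E"
    and "countable V" and "infinite V"
    and "\<And>v. v \<in> V - {tree_root V E} \<Longrightarrow> lam v > 0"
    and "bounded_operator V (ell2 V) (weighted_shift V E lam)"
    and "balanced V E lam"
    and "left_invertible V (weighted_shift V E lam)"
    and "finite_dimensional (ker_adj V (weighted_shift V E lam))"
    and "separated_basis V E lam J b"
  shows "generalized_multipliers V (weighted_shift V E lam) =
    {\<phi>. (\<forall>n. \<phi> n \<in> bounded_operators V (ker_adj V (weighted_shift V E lam))) \<and>
         (\<forall>i\<in>J. \<forall>j\<in>J. (\<lambda>n. ell2_inner V (\<phi> n (b j)) (b i)) \<in>
            H_inf (\<lambda>n. (ell2_norm V ((weighted_shift V E lam ^^ n) (unit_vec (tree_root V E))))\<^sup>2))}"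
proof -
  interpret balanced_tree_shift V E lam
    by unfold_locales fact+
  show ?thesis
    \<comment> \<open>The weight in the statement becomes the product \<beta> used in the
      locale.\<close>
    unfolding beta_root by (rule generalized_multipliers_eq) fact+
qed

end
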